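(* Let $q$ be a prime power with $q\equiv 1\pmod 4$, say $q=2^Am+1$ with $A\ge 2$ and $m$ odd. Let $r\ge 3$ be odd such that $\gcd(q,r)=1$, let $d_r=\operatorname{ord}_r(q)$ and $K=v_2(q^{d_r}-1)$. 1. If $1\le n\le A$, then $$\Phi_{2^nr}(x)=\prod_{u\in U_n}\prod_{w\in\Omega(r)}\left(\sum_{i=0}^{d_r}u^iS_{i,w}x^{d_r-i}\right)$$ is the complete factorization of $\Phi_{2^nr}$ over $\mathbb{F}_q$. 2. If $n>A$, we have: (a) If $d_r$ is odd, then $$\Phi_{2^nr}(x)=\prod_{u\in U_A}\prod_{w\in\Omega(r)}\left(\sum_{i=0}^{d_r}u^iS_{i,w}x^{2^{n-A}(d_r-i)}\right)$$ is the complete factorization of $\Phi_{2^nr}$ over $\mathbb{F}_q$. (b) If $d_r$ is even, then: (i) For $A<n\le K$, the complete factorization of $\Phi_{2^nr}$ over $\mathbb{F}_q$ is given by $$\Phi_{2^nr}(x)=\prod_{u\in U_A}\prod_{w\in\Omega(r)}\left(x^{d_r}+\sum_{i=1}^{d_r}a_{n_i}x^{d_r-i}\right),$$ where the $a_{n_i}\in\mathbb{F}_q$, $1\le i\le d_r$, satisfy the system of non-linear recurrence relations $$\sum_{i+j=2k}(-1)^ja_{n_i}a_{n_j}=a_{(n-1)_k},\qquad 1\le k\le d_r,$$ with initial values $a_{A_k}=u^kS_{k,w}$, $1\le k\le d_r$. (ii) For $n>K$, the complete factorization of $\Phi_{2^nr}$ over $\mathbb{F}_q$ is given by $$\Phi_{2^nr}(x)=\prod_{u\in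 U_A}\prod_{w\in\Omega(r)}\left(x^{2^{n-K}d_r}+\sum_{i=1}^{d_r}a_{K_i}x^{2^{n-K}(d_r-i)}\right),$$ where the $a_{K_i}$, $1\le i\le d_r$, are as obtained in (i) for $n=K$.
   Context: $\Phi_m$ is the $m$-th cyclotomic polynomial regarded over $\mathbb{F}_q$; $\operatorname{ord}_r(q)$ is the multiplicative order of $q$ modulo $r$; $v_2(k)$ is the exponent of the highest power of $2$ dividing $k$. $U_n$ is the set of primitive $2^n$-th roots of unity and $\Omega(r)$ the set of primitive $r$-th roots of unity in the algebraic closure of $\mathbb{F}_q$. For $w\in\Omega(r)$ (so $\mathbb{F}_q(w)=\mathbb{F}_{q^{d_r}}$), $S_{i,w}=S_i(w,w^q,\dots,w^{q^{d_r-1}})$, where $S_i$ is the $i$-th elementary symmetric polynomial in $d_r$ variables and $S_0=1$. Convention on products: an expression $\prod_{a\in A}\cdots\prod_{b\in B}f(x,a,\dots,b)$ denotes the product of the *distinct* polynomials $f(x,a,\dots,b)$ arising for $a\in A,\dots,b\in B$ (each distinct polynomial taken once). "Complete factorization" means that the factors are irreducible over $\mathbb{F}_q$. In the recurrence, $a_{n_0}=1$ and the indices $i,j$ range over $0\le i,j\le d_r$. At each step from $n-1$ to $n$, a tuple $(a_{(n-1)_k})_k$ gives rise to all solutions $(a_{n_i})_i\in\mathbb{F}_q^{d_r}$ of the system (if $f(x)=x^{d_r}+\sum_i a_{n_i}x^{d_r-i}$ is one of them, so is $f(-x)$); the products in (b) are over all distinct polynomials obtained from all solutions, starting from all initial values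 $u\in U_A$, $w\in\Omega(r)$.
   Formalization: In part 1 with n = 1 the factors use (-u)^i in place of u^i, because the printed product there equals Φ_r rather than Φ_{2r} (e.g. q = 5, r = 3 gives x²+x+1, not x²−x+1); for 2 ≤ n ≤ A and all other parts the formulas are as printed. *)

theory Defs
  imports
    "HOL-Algebra.Algebraic_Closure_Type"
    Complex_Main
    "HOL-Library.Cardinality"
    "HOL-Computational_Algebra.Computational_Algebra"
    "HOL-Number_Theory.Number_Theory"
begin

definition primitive_roots_of_unity :: "nat \<Rightarrow> 'b::field set" where
  "primitive_roots_of_unity n =
     {z. 0 < n \<and> z ^ n = 1 \<and> (\<forall>k. 0 < k \<and> k < n \<longrightarrow> z ^ k \<noteq> 1)}"

text \<open>
  The cyclotomic polynomial over the integers; that the definite description is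
  proper is shown in \<open>cyclotomic_int_ex1\<close> below.
\<close>

definition cyclotomic_int :: "nat \<Rightarrow> int poly" where
  "cyclotomic_int n =
     (THE p. map_poly of_int p = (\<Prod>z\<in>primitive_roots_of_unity n. [:- z, 1 :: complex:]))"

definition cyclotomic :: "nat \<Rightarrow> 'a::field poly" where
  "cyclotomic n = map_poly of_int (cyclotomic_int n)"

definition elem_sym :: "nat \<Rightarrow> nat \<Rightarrow> (nat \<Rightarrow> 'b::field) \<Rightarrow> 'b" where
  "elem_sym d i x = (\<Sum>J\<in>{J. J \<subseteq> {..<d} \<and> card J = i}. \<Prod>j\<in>J. x j)"

definition conj_sym :: "nat \<Rightarrow> nat \<Rightarrow> nat \<Rightarrow> 'b::field \<Rightarrow> 'b" where
  "conj_sym q d i w = elem_sym d i (\<lambda>j. w ^ (q ^ j))"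

text \<open>
  A product over the distinct members of a family of polynomials is the product over
  the set of its members.  The finiteness condition is needed because \<open>prod\<close> is \<open>1\<close> on
  infinite sets.
\<close>

definition complete_factorization :: "'a::field poly \<Rightarrow> 'a poly set \<Rightarrow> bool" where
  "complete_factorization p F \<longleftrightarrow> finite F \<and> p = (\<Prod>f\<in>F. f) \<and> (\<forall>f\<in>F. irreducible f)"

text \<open>
  The same for a set \<open>P\<close> of polynomials given by coefficients in the algebraic closure; that
  these coefficients lie in the base field is part of the assertion.
\<close>

definition complete_factorization_ac :: "'a::field poly \<Rightarrow> 'a alg_closure poly set \<Rightarrow> bool" where
  "complete_factorization_ac p P \<longleftrightarrow>
     (\<exists>F. map_poly to_ac ` F = P \<and> complete_factorization p F)"

text \<open>
  \<open>recurrence_solution q d A u w n a\<close>: the tuple \<open>(a 0, \<dots>, a d)\<close> with \<open>a 0 = 1\<close> is a level \<open>n\<close>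
  solution of the recurrence with initial values at level \<open>A\<close> determined by \<open>u\<close> and \<open>w\<close>.
  Tuples are functions on \<^typ>\<open>nat\<close> whose values beyond \<open>d\<close> are irrelevant.
\<close>

inductive recurrence_solution ::
  "nat \<Rightarrow> nat \<Rightarrow> nat \<Rightarrow> 'a::field alg_closure \<Rightarrow> 'a alg_closure \<Rightarrow> nat \<Rightarrow> (nat \<Rightarrow> 'a) \<Rightarrow> bool"
  for q d A u w where
  initial: "a 0 = 1 \<Longrightarrow> (\<forall>k\<in>{1..d}. to_ac (a k) = u ^ k * conj_sym q d k w) \<Longrightarrow>
    recurrence_solution q d A u w A a"
| step: "recurrence_solution q d A u w n b \<Longrightarrow> a 0 = 1 \<Longrightarrow>
    (\<forall>k\<in>{1..d}. (\<Sum>(i, j)\<in>{(i, j). i \<le> d \<and> j \<le> d \<and> i + j = 2 * k}. (-1) ^ j * a i * a j) = b k) \<Longrightarrow>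
    recurrence_solution q d A u w (Suc n) a"


lemma monic_int_division:
  fixes p g :: "int poly"
  assumes "lead_coeff g = 1"
  shows "\<exists>s t. p = g * s + t \<and> (t = 0 \<or> degree t < degree g)"
proof -
  obtain s t where st: "pseudo_divmod p g = (s, t)" by fastforce
  have g: "g \<noteq> 0" using assms by auto
  from pseudo_divmod[OF g st] show ?thesis using assms by auto
qed

lemma finite_primitive_roots: "finite (primitive_roots_of_unity n :: 'b::field set)"
proof (cases "n = 0")
  case True
  then show ?thesis by (simp add: primitive_roots_of_unity_def)
next
  case False
  have "finite {z :: 'b. poly (monom 1 n - 1) z = 0}"
  proof (rule poly_roots_finite)
    have "coeff (monom 1 n - 1 :: 'b poly) n = 1" using False by simp
    then show "monom 1 n - 1 \<noteq> (0 :: 'b poly)" by (metis coeff_0 zero_neq_one)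
  qed
  then show ?thesis
    by (rule rev_finite_subset) (auto simp: primitive_roots_of_unity_def poly_monom)
qed

lemma roots_of_unity_UN:
  assumes "n > 0"
  shows "{z :: 'b::field. z ^ n = 1} = (\<Union>k\<in>{k. k dvd n}. primitive_roots_of_unity k)"
proof (intro equalityI subsetI)
  fix z :: 'b assume "z \<in> {z. z ^ n = 1}"
  hence z: "z ^ n = 1" by simp
  define k where "k = (LEAST k. 0 < k \<and> z ^ k = 1)"
  have k: "0 < k \<and> z ^ k = 1" unfolding k_def by (rule LeastI[of _ n]) (use z assms in auto)
  have min: "z ^ j \<noteq> 1" if "0 < j" "j < k" for j
    using not_less_Least[of j "\<lambda>k. 0 < k \<and> z ^ k = 1"] that by (auto simp: k_def)
  have "z ^ n = (z ^ k) ^ (n div k) * z ^ (n mod k)"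
    by (simp flip: power_mult power_add)
  hence "z ^ (n mod k) = 1" using z k by simp
  hence "n mod k = 0" using min[of "n mod k"] k by (metis gr0I mod_less_divisor)
  thus "z \<in> (\<Union>k\<in>{k. k dvd n}. primitive_roots_of_unity k)"
    using k min by (auto simp: primitive_roots_of_unity_def)
next
  fix z :: 'b assume "z \<in> (\<Union>k\<in>{k. k dvd n}. primitive_roots_of_unity k)"
  thus "z \<in> {z. z ^ n = 1}" by (auto simp: primitive_roots_of_unity_def power_mult elim!: dvdE)
qed

lemma primitive_roots_disjoint:
  "k \<noteq> l \<Longrightarrow> primitive_roots_of_unity k \<inter> primitive_roots_of_unity l = {}"
  unfolding primitive_roots_of_unity_def by (cases k l rule: linorder_cases) auto

lemma prod_roots_complex:
  assumes "n > 0"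
  shows "monom 1 n - 1 = (\<Prod>z\<in>{z. z ^ n = 1}. [:- z, 1 :: complex:])"
proof -
  define p where "p = (monom 1 n - 1 :: complex poly)"
  define R where "R = (\<Prod>z\<in>{z. z ^ n = 1}. [:- z, 1 :: complex:])"
  have fin: "finite {z::complex. z ^ n = 1}" using assms by (simp add: finite_roots_unity)
  have degR: "degree R = n" unfolding R_def
    by (subst degree_prod_eq_sum_degree) (use card_roots_unity_eq[OF assms] in auto)
  have lcR: "lead_coeff R = 1" unfolding R_def by (simp add: lead_coeff_prod)
  have cp: "coeff p n = 1" using assms by (simp add: p_def)
  have degp: "degree p \<le> n" unfolding p_def
    by (rule degree_diff_le) (auto simp: degree_monom_le)
  have "p - R = 0"
  proof (rule ccontr)
    assume ne: "p - R \<noteq> 0"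
    have "degree (p - R) \<le> n" using degp degR by (simp add: degree_diff_le)
    moreover have "coeff (p - R) n = 0" using cp lcR degR by simp
    ultimately have lt: "degree (p - R) < n"
      using ne by (metis le_neq_implies_less leading_coeff_0_iff)
    have "{z. z ^ n = 1} \<subseteq> {z. poly (p - R) z = 0}"
      using fin by (auto simp: p_def R_def poly_monom poly_prod intro!: prod_zero)
    hence "card {z::complex. z ^ n = 1} \<le> card {z. poly (p - R) z = 0}"
      by (intro card_mono poly_roots_finite ne)
    also have "\<dots> \<le> degree (p - R)" by (rule card_poly_roots_bound[OF ne])
    finally show False using lt card_roots_unity_eq[OF assms] by simp
  qed
  thus ?thesis by (simp add: p_def R_def)
qed

lemma map_poly_of_int_inj:
  "map_poly of_int p = (map_poly of_int s :: complex poly) \<Longrightarrow> p = s"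
  by (rule poly_eqI) (metis coeff_map_poly of_int_0 of_int_eq_iff)

lemma map_poly_of_int_mult:
  "map_poly of_int (p * s) = (map_poly of_int p * map_poly of_int s :: complex poly)"
  by (rule poly_eqI) (simp add: coeff_map_poly coeff_mult)

lemma map_poly_of_int_add:
  "map_poly of_int (p + s) = (map_poly of_int p + map_poly of_int s :: complex poly)"
  by (rule poly_eqI) (simp add: coeff_map_poly)

lemma map_poly_of_int_prod:
  "map_poly of_int (\<Prod>x\<in>S. f x) = (\<Prod>x\<in>S. map_poly of_int (f x) :: complex poly)"
  by (induction S rule: infinite_finite_induct) (auto simp: map_poly_of_int_mult)

lemma cyclotomic_int_ex:
  "\<exists>p. map_poly of_int p = (\<Prod>z\<in>primitive_roots_of_unity n. [:- z, 1 :: complex:])"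
proof (induction n rule: less_induct)
  case (less n)
  define C where "C k = (\<Prod>z\<in>primitive_roots_of_unity k. [:- z, 1 :: complex:])" for k
  show ?case
  proof (cases "n = 0")
    case True
    then show ?thesis by (auto simp: primitive_roots_of_unity_def intro!: exI[of _ 1])
  next
    case False
    hence n: "n > 0" by simp
    have "\<forall>k\<in>{..<n}. \<exists>p. map_poly of_int p = C k" using less by (auto simp: C_def)
    then obtain P where P: "\<And>k. k < n \<Longrightarrow> map_poly of_int (P k) = C k" by (metis lessThan_iff)
    define D where "D = {k. k dvd n} - {n}"
    have D: "finite D" "D \<subseteq> {..<n}" "{k. k dvd n} = insert n D" "n \<notin> D"
      using n by (auto simp: D_def dest: dvd_imp_le intro: le_neq_implies_less)
    define G where "G = (\<Prod>k\<in>D. P k)"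
    have G: "map_poly of_int G = (\<Prod>k\<in>D. C k)"
      using D P by (auto simp: G_def map_poly_of_int_prod intro!: prod.cong)
    have lcC: "lead_coeff (C k) = 1" for k by (simp add: C_def lead_coeff_prod)
    have lc: "lead_coeff (map_poly of_int G :: complex poly) = 1"
      by (simp add: G lead_coeff_prod lcC)
    have deg: "degree (map_poly of_int p :: complex poly) = degree p" for p
      by (rule degree_map_poly) auto
    have "of_int (lead_coeff G) = (1 :: complex)"
      using lc by (simp add: deg coeff_map_poly)
    hence lcG: "lead_coeff G = 1" using of_int_eq_1_iff by blast
    have "monom 1 n - 1 = (\<Prod>z\<in>{z. z ^ n = 1}. [:- z, 1 :: complex:])"
      by (rule prod_roots_complex[OF n])
    also have "\<dots> = (\<Prod>k\<in>insert n D. C k)"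
      unfolding roots_of_unity_UN[OF n] C_def D(3)
      by (rule prod.UNION_disjoint)
        (use D in \<open>simp_all add: primitive_roots_disjoint finite_primitive_roots\<close>)
    also have "\<dots> = C n * map_poly of_int G" using D by (simp add: G)
    finally have fac: "monom 1 n - 1 = C n * map_poly of_int G" .
    obtain s t where st: "monom 1 n - 1 = G * s + t" "t = 0 \<or> degree t < degree G"
      using monic_int_division[OF lcG] by blast
    have "map_poly of_int (monom 1 n - 1) = (monom 1 n - 1 :: complex poly)"
      by (rule poly_eqI) (simp add: coeff_map_poly)
    hence "C n * map_poly of_int G = map_poly of_int G * map_poly of_int s + map_poly of_int t"
      using fac st(1) by (simp add: map_poly_of_int_mult map_poly_of_int_add)
    hence eq: "map_poly of_int t = map_poly of_int G * (C n - map_poly of_int s)"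
      by (simp add: algebra_simps)
    have "C n - map_poly of_int s = 0"
    proof (rule ccontr)
      assume ne: "C n - map_poly of_int s \<noteq> 0"
      have g0: "map_poly of_int G \<noteq> (0 :: complex poly)" using lc by auto
      have "degree t = degree G + degree (C n - map_poly of_int s)"
        using arg_cong[OF eq, of degree] ne g0 by (simp add: deg degree_mult_eq)
      moreover have "t \<noteq> 0" using eq ne g0 by auto
      ultimately show False using st(2) by simp
    qed
    thus ?thesis by (auto simp: C_def intro!: exI[of _ s])
  qed
qed

lemma cyclotomic_int_ex1:
  "\<exists>!p. map_poly of_int p = (\<Prod>z\<in>primitive_roots_of_unity n. [:- z, 1 :: complex:])"
  using cyclotomic_int_ex map_poly_of_int_inj by metis

lemma of_int_cyclotomic_int:
  "map_poly of_int (cyclotomic_int n) =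
     (\<Prod>z\<in>primitive_roots_of_unity n. [:- z, 1 :: complex:])"
  unfolding cyclotomic_int_def by (rule theI'[OF cyclotomic_int_ex1])

end

theory Submission
  imports Defs
begin

text \<open>
  A monic polynomial over \<open>\<F>\<^sub>q\<close> of degree \<open>ord\<^sub>N(q)\<close> with a primitive \<open>N\<close>-th root of unity
  \<open>z\<close> as a root is irreducible and equals \<open>\<Prod>\<^sub>j (X - z\<^bsup>q^j\<^esup>)\<close>, because the conjugates
  of \<open>z\<close> are \<open>ord\<^sub>N(q)\<close> distinct roots of every polynomial over \<open>\<F>\<^sub>q\<close> that vanishes at \<open>z\<close>.
  So a set of such polynomials is the complete factorization of \<open>\<Phi>\<^sub>N\<close> as soon as every primitive
  \<open>N\<close>-th root of unity is a root of one of its members.  Lifting the exponent gives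
  \<open>ord\<^sub>N(q) = 2\<^bsup>max(n-K,0)\<^esup> d\<^sub>r\<close> for \<open>N = 2\<^sup>n r\<close>, which is the degree of the
  claimed factors, and substituting \<open>X\<^bsup>2^k\<^esup>\<close> turns roots of order \<open>N\<close> into roots of order
  \<open>2\<^sup>k N\<close> if \<open>N\<close> is even.  The recurrence says that \<open>f\<^sub>n(X) f\<^sub>n(-X) = f\<^sub>n\<^sub>-\<^sub>1(X\<^sup>2)\<close>: a root of
  \<open>f\<^sub>n\<close> is a square root of a root of \<open>f\<^sub>n\<^sub>-\<^sub>1\<close>, and conversely the minimal polynomials of
  \<open>z\<close> and \<open>z\<^sup>2\<close> are related in this way.
\<close>

section \<open>Primitive roots of unity under products, powers and square roots\<close>

lemma primitive_root_power_eq_1_iff: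
  assumes "z \<in> primitive_roots_of_unity n"
  shows "z ^ k = 1 \<longleftrightarrow> n dvd k"
proof
  have n: "n > 0" "z ^ n = 1" "\<And>k. 0 < k \<Longrightarrow> k < n \<Longrightarrow> z ^ k \<noteq> 1"
    using assms by (auto simp: primitive_roots_of_unity_def)
  have "z ^ k = (z ^ n) ^ (k div n) * z ^ (k mod n)"
    by (simp flip: power_mult power_add)
  hence *: "z ^ k = z ^ (k mod n)" using n by simp
  show "n dvd k" if "z ^ k = 1"
    using that * n by (metis gr0I mod_less_divisor dvd_eq_mod_eq_0)
  show "z ^ k = 1" if "n dvd k" using that n by (auto simp: power_mult)
qed

lemma primitive_root_iff:
  "z \<in> primitive_roots_of_unity n \<longleftrightarrow> n > 0 \<and> (\<forall>k. z ^ k = 1 \<longleftrightarrow> n dvd k)"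
proof
  assume z: "z \<in> primitive_roots_of_unity n"
  thus "n > 0 \<and> (\<forall>k. z ^ k = 1 \<longleftrightarrow> n dvd k)"
    using primitive_root_power_eq_1_iff[OF z] by (auto simp: primitive_roots_of_unity_def)
qed (auto simp: primitive_roots_of_unity_def dest: dvd_imp_le)

lemma primitive_root_nonzero: "z \<in> primitive_roots_of_unity n \<Longrightarrow> z \<noteq> 0"
  by (auto simp: primitive_roots_of_unity_def power_0_left)

lemma primitive_root_power_eq_iff:
  assumes "z \<in> primitive_roots_of_unity n"
  shows "z ^ i = z ^ j \<longleftrightarrow> [i = j] (mod n)"
proof -
  have *: "z ^ i = z ^ j \<longleftrightarrow> [i = j] (mod n)" if "i \<le> j" for i j
  proof -
    have "z ^ j = z ^ i * z ^ (j - i)" using that by (simp flip: power_add)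
    hence "z ^ i = z ^ j \<longleftrightarrow> z ^ (j - i) = 1" using primitive_root_nonzero[OF assms] by auto
    also have "\<dots> \<longleftrightarrow> [j = i] (mod n)"
      using that primitive_root_power_eq_1_iff[OF assms] by (simp only: cong_altdef_nat)
    finally show ?thesis by (simp only: cong_sym_eq)
  qed
  show ?thesis using *[of i j] *[of j i] by (cases "i \<le> j") (auto simp: cong_sym_eq)
qed

text \<open>If (u w)^k = 1, the n-th power removes w and the m-th power removes u, so coprimality
  gives m | k and n | k.\<close>

lemma primitive_root_mult:
  assumes "u \<in> primitive_roots_of_unity m" "w \<in> primitive_roots_of_unity n" "coprime m n"
  shows "u * w \<in> primitive_roots_of_unity (m * n)"
  unfolding primitive_root_iff
proof (intro conjI allI iffI)
  show "m * n > 0" using assms by (simp add: primitive_root_iff)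
  fix k
  have u: "u ^ k = 1 \<longleftrightarrow> m dvd k" and w: "w ^ k = 1 \<longleftrightarrow> n dvd k" for k
    using assms by (simp_all add: primitive_root_iff)
  show "(u * w) ^ k = 1" if "m * n dvd k"
    using that u[of k] w[of k] by (auto simp: power_mult_distrib dest: dvd_mult_left dvd_mult_right)
  assume k: "(u * w) ^ k = 1"
  have "(u * w) ^ (k * n) = 1" "(u * w) ^ (k * m) = 1" using k by (simp_all add: power_mult)
  moreover have "w ^ (k * n) = 1" "u ^ (k * m) = 1" by (simp_all add: u w)
  ultimately have "m dvd k * n" "n dvd k * m" by (simp_all add: power_mult_distrib u w)
  hence "m dvd k" "n dvd k" using assms(3)
    by (simp_all add: coprime_dvd_mult_left_iff coprime_commute)
  thus "m * n dvd k" using assms(3) by (simp add: divides_mult)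
qed

lemma primitive_root_power_mult:
  assumes "z \<in> primitive_roots_of_unity (m * n)"
  shows "z ^ m \<in> primitive_roots_of_unity n"
  using assms by (auto simp: primitive_root_iff simp flip: power_mult)

lemma primitive_root_power_coprime:
  assumes "z \<in> primitive_roots_of_unity n" "coprime k n"
  shows "z ^ k \<in> primitive_roots_of_unity n"
  using assms
  by (auto simp: primitive_root_iff coprime_commute coprime_dvd_mult_right_iff simp flip: power_mult)

text \<open>With n a = 1 modulo m and m b = 1 modulo n, the exponents n a and m b are the
  idempotents of the Chinese remainder theorem. They add up to 1 modulo m n, so z is the product of
  z^(n a), of order m, and z^(m b), of order n.\<close>

lemma primitive_root_decompose:
  assumes "z \<in> primitive_roots_of_unity (m * n)" "coprime m n"
  obtains u w where "u \<in> primitive_roots_of_unity m" "w \<in> primitive_roots_of_unity n" "z = u * w"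
proof -
  have pos: "m > 0" "n > 0" using assms(1) by (simp_all add: primitive_root_iff)
  obtain a where a: "[n * a = 1] (mod m)"
    using cong_solve_coprime_nat[of n m] assms(2) by (auto simp: coprime_commute)
  obtain b where b: "[m * b = 1] (mod n)"
    using cong_solve_coprime_nat[of m n] assms(2) by auto
  have ca: "coprime a m" "coprime b n"
    using a b by (metis coprime_1_left cong_imp_coprime cong_sym coprime_mult_left_iff)+
  show ?thesis
  proof (rule that[of "(z ^ n) ^ a" "(z ^ m) ^ b"])
    show "(z ^ n) ^ a \<in> primitive_roots_of_unity m" "(z ^ m) ^ b \<in> primitive_roots_of_unity n"
      using primitive_root_power_coprime[OF primitive_root_power_mult, of z n m a]
        primitive_root_power_coprime[OF primitive_root_power_mult, of z m n b] assms(1) ca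
      by (simp_all only: mult.commute[of n m])
    have "[n * a + m * b = 1 + 0] (mod m)"
      by (intro cong_add a) (simp add: cong_0_iff)
    moreover have "[n * a + m * b = 0 + 1] (mod n)"
      by (intro cong_add b) (simp add: cong_0_iff)
    ultimately have "[n * a + m * b = 1] (mod (m * n))"
      using assms(2) by (auto intro: coprime_cong_mult_nat)
    hence "z ^ (n * a + m * b) = z ^ 1"
      using primitive_root_power_eq_iff[OF assms(1)] by blast
    thus "z = (z ^ n) ^ a * (z ^ m) ^ b" by (simp add: power_add power_mult)
  qed
qed

text \<open>From z^k = 1 one first gets n | k. As n is even, so is k, hence z^k is a power of z^2
  and n divides k / 2. For odd n a square root could have order n itself.\<close>

lemma primitive_root_sqrt:
  assumes "z ^ 2 \<in> primitive_roots_of_unity n" "even n"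
  shows "z \<in> primitive_roots_of_unity (2 * n)"
  unfolding primitive_root_iff
proof (intro conjI allI iffI)
  show "2 * n > 0" using assms by (simp add: primitive_root_iff)
  fix k
  have *: "z ^ (2 * k) = 1 \<longleftrightarrow> n dvd k" for k
    using assms by (simp add: primitive_root_iff power_mult)
  show "z ^ k = 1" if "2 * n dvd k"
    using that * by (auto simp: mult.assoc elim!: dvdE)
  assume k: "z ^ k = 1"
  hence "z ^ (2 * k) = 1" by (simp add: mult.commute[of 2] power_mult)
  hence "even k" using * assms(2) by (meson dvd_trans)
  thus "2 * n dvd k" using k * by (auto elim!: evenE)
qed

lemma primitive_root_power_two_iff:
  assumes "k = 0 \<or> even n"
  shows "z ^ (2 ^ k) \<in> primitive_roots_of_unity n \<longleftrightarrow> z \<in> primitive_roots_of_unity (2 ^ k * n)"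
proof
  show "z \<in> primitive_roots_of_unity (2 ^ k * n)" if "z ^ (2 ^ k) \<in> primitive_roots_of_unity n"
    using that assms
  proof (induction k arbitrary: z)
    case (Suc k)
    hence "z ^ 2 \<in> primitive_roots_of_unity (2 ^ k * n)"
      by (simp add: power_mult)
    with Suc.prems show ?case
      using primitive_root_sqrt[of z "2 ^ k * n"] by (simp add: mult.assoc)
  qed auto
qed (rule primitive_root_power_mult)

text \<open>The common square of z and \<open>- z\<close> has the even order n / 2, so each of its
  square roots has order n.\<close>

lemma primitive_root_uminus:
  assumes "z \<in> primitive_roots_of_unity n" "4 dvd n"
  shows "- z \<in> primitive_roots_of_unity n"
proof -
  obtain m where m: "n = 2 * (2 * m)" using assms(2) by (auto elim!: dvdE)
  have "(-z) ^ 2 \<in> primitive_roots_of_unity (2 * m)"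
    using primitive_root_power_mult[of z 2 "2 * m"] assms(1) by (simp add: m)
  thus ?thesis using primitive_root_sqrt[of "-z" "2 * m"] by (simp add: m)
qed

section \<open>Lifting the exponent at 2 and the order of q modulo 2^n r\<close>

text \<open>Strong induction on e. For odd e the cofactor of y - 1 is a sum of e odd terms, hence
  odd. For e = 2 f the new factor y^f + 1 is 2 modulo 4, because y is 1 modulo 4, and contributes
  exactly one factor 2.\<close>

lemma multiplicity_2_power_minus_1:
  fixes y :: nat
  assumes "y > 1" "[y = 1] (mod 4)" "e > 0"
  shows "multiplicity 2 (y ^ e - 1) = multiplicity 2 (y - 1) + multiplicity 2 e"
  using assms(3)
proof (induction e rule: less_induct)
  case (less e)
  have y: "y mod 4 = 1" using assms(2) by (simp add: cong_def)
  hence oddy: "odd y" by presburger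
  have p: "prime_elem (2::nat)" by simp
  show ?case
  proof (cases "even e")
    case False
    have "int (y ^ e - 1) = int ((y - 1) * (\<Sum>i<e. y ^ i))"
      using power_diff_1_eq[of "int y" e] assms(1) by (simp add: of_nat_diff)
    hence eq: "y ^ e - 1 = (y - 1) * (\<Sum>i<e. y ^ i)" by (simp only: of_nat_eq_iff)
    have "even (\<Sum>i<k. y ^ i) \<longleftrightarrow> even k" for k by (induction k) (use oddy in auto)
    hence "odd (\<Sum>i<e. y ^ i)" using False by simp
    hence "multiplicity 2 (\<Sum>i<e. y ^ i) = 0" "(\<Sum>i<e. y ^ i) \<noteq> 0"
      using not_dvd_imp_multiplicity_0 odd_pos by blast+
    moreover have "multiplicity 2 e = 0" using False by (simp add: not_dvd_imp_multiplicity_0)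
    ultimately show ?thesis unfolding eq
      using assms(1) by (subst prime_elem_multiplicity_mult_distrib[OF p]) auto
  next
    case True
    then obtain f where f: "e = 2 * f" by (auto elim!: evenE)
    have f0: "f > 0" "f < e" using less.prems f by auto
    have gt: "y ^ f > 1" by (rule one_less_power[OF assms(1) f0(1)])
    have "y ^ e - 1 = (y ^ f - 1) * (y ^ f + 1)"
    proof -
      have "x * x - 1 = (x - 1) * (x + 1)" for x :: nat by (cases x) auto
      thus ?thesis by (simp only: f mult_2 power_add)
    qed
    moreover have "multiplicity 2 (y ^ f + 1) = 1"
    proof -
      have "x mod 4 = 1 \<Longrightarrow> x + 1 = 2 * (2 * (x div 4) + 1)" for x :: nat by presburger
      moreover have "y ^ f mod 4 = 1"
        using cong_pow[OF assms(2), of f] by (simp add: cong_def)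
      ultimately obtain t where t: "y ^ f + 1 = 2 * (2 * t + 1)" by blast
      show ?thesis unfolding t
        by (subst prime_elem_multiplicity_mult_distrib[OF p]) (auto simp: not_dvd_imp_multiplicity_0)
    qed
    moreover have "multiplicity 2 e = 1 + multiplicity 2 f" unfolding f
      using f0 by (subst prime_elem_multiplicity_mult_distrib[OF p]) auto
    moreover have "multiplicity 2 ((y ^ f - 1) * (y ^ f + 1)) = multiplicity 2 (y ^ f - 1) + multiplicity 2 (y ^ f + 1)"
      using gt by (subst prime_elem_multiplicity_mult_distrib[OF p]) auto
    ultimately show ?thesis using less.IH[OF f0(2,1)] by simp
  qed
qed

text \<open>Modulo r the exponents t with q^t = 1 are the multiples t = d e of d. For these, lifting
  the exponent turns the congruence modulo 2^n into 2^(n-K) | e. The subtraction is truncated, so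
  the order stays d as long as n \<le> K.\<close>

lemma ord_two_power_mult:
  fixes q r n :: nat
  assumes "q > 1" "[q = 1] (mod 4)" "odd r" "coprime q r"
  defines "d \<equiv> ord r q"
  shows "ord (2 ^ n * r) q = 2 ^ (n - multiplicity 2 (q ^ d - 1)) * d"
proof -
  define K where "K = multiplicity 2 (q ^ d - 1)"
  have d: "d > 0" using assms by (simp add: d_def coprime_commute)
  have qd: "q ^ d > 1" "[q ^ d = 1] (mod 4)"
    using one_less_power[OF assms(1) d] cong_pow[OF assms(2), of d] by simp_all
  have two: "[q ^ (d * e) = 1] (mod 2 ^ n) \<longleftrightarrow> 2 ^ (n - K) dvd e" for e
  proof (cases "e = 0")
    case False
    have "q ^ (d * e) > 1" using one_less_power[OF assms(1), of "d * e"] d False by simp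
    hence "[q ^ (d * e) = 1] (mod 2 ^ n) \<longleftrightarrow> 2 ^ n dvd (q ^ d) ^ e - 1"
      using cong_altdef_nat[of 1 "q ^ (d * e)" "2 ^ n"] by (simp add: power_mult)
    also have "\<dots> \<longleftrightarrow> n \<le> multiplicity 2 ((q ^ d) ^ e - 1)"
      using \<open>q ^ (d * e) > 1\<close> by (subst power_dvd_iff_le_multiplicity) (auto simp: power_mult)
    also have "\<dots> \<longleftrightarrow> n - K \<le> multiplicity 2 e"
      using multiplicity_2_power_minus_1[OF qd, of e] False by (auto simp: K_def)
    also have "\<dots> \<longleftrightarrow> 2 ^ (n - K) dvd e"
      using False by (subst power_dvd_iff_le_multiplicity) auto
    finally show ?thesis .
  qed auto
  have co: "coprime (2 ^ n) r" using assms(3) by simp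
  \<comment> \<open>The two numbers are equal because they have the same multiples.\<close>
  have "ord (2 ^ n * r) q dvd t \<longleftrightarrow> 2 ^ (n - K) * d dvd t" for t
  proof -
    have "ord (2 ^ n * r) q dvd t \<longleftrightarrow> [q ^ t = 1] (mod 2 ^ n) \<and> d dvd t"
      unfolding ord_modulus_mult_coprime[OF co] by (simp add: ord_divides' d_def)
    also have "\<dots> \<longleftrightarrow> 2 ^ (n - K) * d dvd t"
    proof (cases "d dvd t")
      case True
      then obtain e where t: "t = d * e" by (elim dvdE)
      have "2 ^ (n - K) * d dvd d * e \<longleftrightarrow> 2 ^ (n - K) dvd e"
        using d by (subst mult.commute) simp
      thus ?thesis by (simp add: t two del: One_nat_def)
    next
      case False
      thus ?thesis by (auto dest: dvd_mult_right)
    qed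
    finally show ?thesis .
  qed
  thus ?thesis by (metis K_def dvd_antisym dvd_refl)
qed

section \<open>The Frobenius map x -> x^q on the finite field and its closure\<close>

text \<open>Multiplication by x \<noteq> 0 permutes the nonzero elements; comparing their products
  gives x^(q-1) = 1.\<close>

lemma power_card_finite_field:
  fixes x :: "'a::{finite,field}"
  shows "x ^ CARD('a) = x"
proof (cases "x = 0")
  case False
  have bij: "bij_betw ((*) x) (- {0}) (- {0})"
    by (rule bij_betw_byWitness[where f' = "\<lambda>y. y / x"]) (use False in auto)
  have "(\<Prod>y\<in>- {0}. y) = (\<Prod>y\<in>- {0}. x * y)"
    by (rule prod.reindex_bij_betw[OF bij, symmetric])
  also have "\<dots> = x ^ card (- {0 :: 'a}) * (\<Prod>y\<in>- {0}. y)"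
    by (simp add: prod.distrib)
  finally have "x ^ card (- {0 :: 'a}) = 1" by simp
  moreover have "CARD('a) = Suc (card (- {0 :: 'a}))"
    using card.remove[of UNIV "0 :: 'a"] by (simp add: Compl_eq_Diff_UNIV)
  ultimately show ?thesis by simp
qed (simp add: power_0_left)

text \<open>
  \<open>(X + 1) ^ q - X ^ q - 1\<close> has degree less than \<open>q\<close> but vanishes on all \<open>q\<close> elements, so it is
  zero.  This avoids showing that \<open>q\<close> is a power of the characteristic.
\<close>
lemma of_nat_card_choose_eq_0:
  assumes "0 < k" "k < CARD('a::{finite,field})"
  shows "of_nat (CARD('a) choose k) = (0 :: 'a)"
proof -
  define q where "q = CARD('a)"
  define P :: "'a poly" where "P = (\<Sum>j\<in>{0<..<q}. monom (of_nat (q choose j)) j)"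
  have q: "q > 1" using assms by (simp add: q_def)
  have "poly P x = 0" for x
  proof -
    have split: "{..q} = insert 0 (insert q {0<..<q})" using q by auto
    have "x + 1 = (x + 1) ^ q" by (simp only: q_def power_card_finite_field)
    also have "\<dots> = (\<Sum>j\<le>q. of_nat (q choose j) * x ^ j)" by (simp add: binomial_ring)
    also have "\<dots> = 1 + (x ^ q + poly P x)"
      unfolding split using q by (simp add: P_def poly_sum poly_monom)
    also have "x ^ q = x" by (simp only: q_def power_card_finite_field)
    finally show ?thesis by simp
  qed
  moreover have "degree P < q"
    unfolding P_def using q
    by (intro le_less_trans[OF degree_sum_le[of _ _ "q - 1"]])
       (auto intro: order_trans[OF degree_monom_le])
  ultimately have "P = 0"
    by (intro poly_eqI_degree[of UNIV P 0]) (simp_all add: q_def)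
  moreover have "coeff P k = of_nat (q choose k)"
    using assms by (simp add: P_def coeff_sum q_def)
  ultimately show ?thesis by (simp add: q_def)
qed

lemma card_field_gt_1: "CARD('a::{finite,field}) > 1"
proof -
  have "card {0, 1 :: 'a} \<le> CARD('a)" by (intro card_mono) auto
  thus ?thesis by simp
qed

lemma of_nat_card_field: "of_nat (CARD('a)) = (0 :: 'a::{finite,field})"
  using of_nat_card_choose_eq_0[of 1, where 'a = 'a] card_field_gt_1[where 'a = 'a] by simp

lemma power_card_add:
  fixes x y :: "'a::{finite,field} alg_closure"
  shows "(x + y) ^ CARD('a) = x ^ CARD('a) + y ^ CARD('a)"
proof -
  define q where "q = CARD('a)"
  have q: "q > 1" using card_field_gt_1[where 'a = 'a] by (simp add: q_def)
  have split: "{..q} = insert 0 (insert q {0<..<q})" using q by auto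
  have z: "of_nat (q choose j) = (0 :: 'a alg_closure)" if "0 < j" "j < q" for j
    using of_nat_card_choose_eq_0[of j, where 'a = 'a] that
    by (metis q_def to_ac_0 to_ac_of_nat)
  have "(x + y) ^ q = (\<Sum>j\<le>q. of_nat (q choose j) * x ^ j * y ^ (q - j))"
    by (rule binomial_ring)
  also have "\<dots> = x ^ q + y ^ q"
    unfolding split using q by (simp add: z)
  finally show ?thesis by (simp add: q_def)
qed

text \<open>Additivity applied to x + (-x) = 0 avoids a case distinction on the parity of q.\<close>

lemma power_card_uminus:
  fixes x :: "'a::{finite,field} alg_closure"
  shows "(- x) ^ CARD('a) = - (x ^ CARD('a))"
  using power_card_add[of x "- x"] card_field_gt_1[where 'a = 'a]
  by (simp add: power_0_left eq_neg_iff_add_eq_0 add.commute)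

text \<open>X^q - X has at most q roots, and the q elements of the base field are roots already, so
  the Frobenius map fixes nothing else.\<close>

lemma power_card_eq_self_imp_range_to_ac:
  fixes x :: "'a::{finite,field} alg_closure"
  assumes "x ^ CARD('a) = x"
  shows "x \<in> range to_ac"
proof -
  define q where "q = CARD('a)"
  have q: "q > 1" using card_field_gt_1[where 'a = 'a] by (simp add: q_def)
  define P :: "'a alg_closure poly" where "P = monom 1 q - [:0, 1:]"
  have "coeff P q = 1" using q by (simp add: P_def coeff_pCons split: nat.split)
  hence P: "P \<noteq> 0" by auto
  have "degree P \<le> q" unfolding P_def
    by (intro degree_diff_le degree_monom_le) (use q in simp)
  hence "card {x. poly P x = 0} \<le> q" using card_poly_roots_bound[OF P] by simp
  moreover have "range to_ac \<subseteq> {x. poly P x = 0}"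
    by (auto simp: P_def poly_monom q_def power_card_finite_field simp flip: to_ac_power)
  moreover have "card (range (to_ac :: 'a \<Rightarrow> _)) = q"
    by (simp add: card_image inj_to_ac q_def)
  ultimately have "range to_ac = {x. poly P x = 0}"
    by (intro card_seteq poly_roots_finite P) simp_all
  thus ?thesis using assms by (simp add: P_def poly_monom q_def)
qed

lemma power_card_power_uminus:
  fixes x :: "'a::{finite,field} alg_closure"
  shows "(- x) ^ CARD('a) ^ j = - (x ^ CARD('a) ^ j)"
proof (induction j)
  case (Suc j)
  have "y ^ CARD('a) ^ Suc j = (y ^ CARD('a) ^ j) ^ CARD('a)" for y :: "'a alg_closure"
    by (simp only: power_Suc2 power_mult)
  thus ?case by (simp add: Suc power_card_uminus)
qed simp

section \<open>Polynomials over the closure and conjugate roots\<close>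

text \<open>Kept general because it serves integer coefficients, the embedding \<open>to_ac\<close>
  and the Frobenius map alike.\<close>

lemma map_poly_mult_hom:
  fixes f :: "'a::comm_semiring_0 \<Rightarrow> 'b::comm_semiring_0"
  assumes "f 0 = 0" "\<And>x y. f (x + y) = f x + f y" "\<And>x y. f (x * y) = f x * f y"
  shows "map_poly f (p * s) = map_poly f p * map_poly f s"
proof (rule poly_eqI)
  have "f (sum g A) = (\<Sum>x\<in>A. f (g x))" if "finite A" for g :: "nat \<Rightarrow> 'a" and A
    using that by induction (auto simp: assms)
  thus "coeff (map_poly f (p * s)) n = coeff (map_poly f p * map_poly f s) n" for n
    by (simp add: coeff_map_poly coeff_mult assms)
qed

lemma map_poly_prod_hom:
  fixes f :: "'a::comm_semiring_1 \<Rightarrow> 'b::comm_semiring_1"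
  assumes "f 0 = 0" "f 1 = 1" "\<And>x y. f (x + y) = f x + f y" "\<And>x y. f (x * y) = f x * f y"
  shows "map_poly f (\<Prod>x\<in>S. g x) = (\<Prod>x\<in>S. map_poly f (g x))"
  by (induction S rule: infinite_finite_induct)
    (simp_all add: map_poly_mult_hom assms)

lemma map_poly_to_ac_eq_iff [simp]: "map_poly to_ac p = map_poly to_ac s \<longleftrightarrow> p = s"
  by (auto simp: poly_eq_iff coeff_map_poly)

lemma degree_map_poly_to_ac [simp]: "degree (map_poly to_ac p) = degree p"
  by (rule degree_map_poly) auto

lemma map_poly_to_ac_mult: "map_poly to_ac (p * s) = map_poly to_ac p * map_poly to_ac s"
  by (rule map_poly_mult_hom) auto

text \<open>The Frobenius map is additive and multiplicative and fixes the coefficients of f, so it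
  commutes with evaluating f. Hence the roots of f are closed under z -> z^q.\<close>

lemma poly_power_card:
  fixes f :: "'a::{finite,field} poly"
  shows "poly (map_poly to_ac f) (z ^ CARD('a)) = poly (map_poly to_ac f) z ^ CARD('a)"
proof (induction f)
  case (pCons a f)
  have "to_ac a ^ CARD('a) = to_ac a" by (simp only: power_card_finite_field flip: to_ac_power)
  thus ?case using pCons
    by (simp add: map_poly_pCons power_card_add power_mult_distrib)
qed (use card_field_gt_1[where 'a = 'a] in \<open>simp add: power_0_left\<close>)

lemma poly_root_conjugate:
  fixes f :: "'a::{finite,field} poly"
  assumes "poly (map_poly to_ac f) z = 0"
  shows "poly (map_poly to_ac f) (z ^ CARD('a) ^ j) = 0"
proof (induction j)
  case (Suc j)
  have "z ^ CARD('a) ^ Suc j = (z ^ CARD('a) ^ j) ^ CARD('a)"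
    by (simp only: power_Suc2 power_mult)
  thus ?case using Suc card_field_gt_1[where 'a = 'a] by (simp add: poly_power_card)
qed (use assms in simp)

section \<open>Cyclotomic polynomials as products over primitive roots in the closure\<close>

lemma monic_eq_prod_roots:
  fixes p :: "'b::idom poly"
  assumes "lead_coeff p = 1" "finite S" "card S = degree p" "\<And>z. z \<in> S \<Longrightarrow> poly p z = 0"
  shows "p = (\<Prod>z\<in>S. [:- z, 1:])"
proof (rule poly_eqI_degree_lead_coeff[where A = S and n = "degree p"])
  have "degree (\<Prod>z\<in>S. [:- z, 1:]) = card S"
    by (subst degree_prod_eq_sum_degree) auto
  moreover have "lead_coeff (\<Prod>z\<in>S. [:- z, 1:]) = 1" by (simp add: lead_coeff_prod)
  ultimately show "coeff p (degree p) = coeff (\<Prod>z\<in>S. [:- z, 1:]) (degree p)"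
      "degree (\<Prod>z\<in>S. [:- z, 1:]) \<le> degree p"
    using assms by simp_all
qed (use assms in \<open>auto simp: poly_prod\<close>)

lemma separable_eq_prod_roots:
  fixes p :: "'b::alg_closed_field poly"
  assumes "lead_coeff p = 1" "\<And>z. poly p z = 0 \<Longrightarrow> poly (pderiv p) z \<noteq> 0"
  shows "p = (\<Prod>z\<in>{z. poly p z = 0}. [:- z, 1:])"
proof -
  have p0: "p \<noteq> 0" using assms by auto
  obtain A where A: "size A = degree p" "p = (\<Prod>x\<in>#A. [:- x, 1:])"
    using alg_closed_imp_factorization[OF p0] assms(1) by auto
  have roots: "{z. poly p z = 0} = set_mset A"
    by (subst A(2)) (auto simp: poly_prod_mset prod_mset_zero_iff)
  \<comment> \<open>A repeated root would put (X - z)^2 into p and make the derivative vanish at z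
    as well.\<close>
  have "count A z = 1" if z: "z \<in># A" for z
  proof (rule ccontr)
    assume "count A z \<noteq> 1"
    moreover have "count A z \<noteq> 0" using z by simp
    ultimately have "2 \<le> count A z" by linarith
    hence "{#z, z#} \<subseteq># A" by (simp add: subseteq_mset_def)
    then obtain B where B: "A = {#z, z#} + B" by (metis subset_mset.add_diff_inverse)
    define g where "g = (\<Prod>x\<in>#B. [:- x, 1:])"
    have "p = [:- z, 1:] * ([:- z, 1:] * g)"
      by (subst A(2)) (simp add: B g_def)
    hence "poly p z = 0" "poly (pderiv p) z = 0"
      by (simp_all only: pderiv_mult poly_add poly_mult) simp_all
    thus False using assms(2) by blast
  qed
  hence "A = mset_set (set_mset A)"
    by (intro multiset_eqI) (simp add: count_mset_set' not_in_iff)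
  hence "(\<Prod>x\<in>#A. [:- x, 1:]) = (\<Prod>z\<in>set_mset A. [:- z, 1:])"
    by (metis prod_unfold_prod_mset)
  thus ?thesis using A(2) unfolding roots by argo
qed

lemma prod_dvd_cyclotomic_int:
  assumes "n > 0"
  shows "(\<Prod>k\<in>{k. k dvd n}. cyclotomic_int k) = monom 1 n - 1"
proof (rule map_poly_of_int_inj)
  have fin: "finite {k. k dvd n}" using assms by simp
  have "map_poly of_int (\<Prod>k\<in>{k. k dvd n}. cyclotomic_int k)
      = (\<Prod>k\<in>{k. k dvd n}. \<Prod>z\<in>primitive_roots_of_unity k. [:- z, 1 :: complex:])"
    by (simp add: map_poly_of_int_prod of_int_cyclotomic_int)
  also have "\<dots> = (\<Prod>z\<in>{z. z ^ n = 1}. [:- z, 1:])"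
    unfolding roots_of_unity_UN[OF assms]
    by (rule prod.UNION_disjoint[symmetric])
      (use fin in \<open>simp_all add: primitive_roots_disjoint finite_primitive_roots\<close>)
  also have "\<dots> = monom 1 n - 1" by (rule prod_roots_complex[OF assms, symmetric])
  also have "\<dots> = map_poly of_int (monom 1 n - 1)"
    by (rule poly_eqI) (simp add: coeff_map_poly)
  finally show "map_poly of_int (\<Prod>k\<in>{k. k dvd n}. cyclotomic_int k) =
      (map_poly of_int (monom 1 n - 1) :: complex poly)" .
qed

lemma prod_roots_of_unity:
  assumes "of_nat n \<noteq> (0 :: 'b::alg_closed_field)"
  shows "monom 1 n - 1 = (\<Prod>z\<in>{z. z ^ n = 1}. [:- z, 1 :: 'b:])"
proof -
  define p where "p = (monom 1 n - 1 :: 'b poly)"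
  have n: "n > 0" using assms by (intro Nat.gr0I) auto
  have c: "coeff p n = 1" using n by (simp add: p_def)
  have "degree p \<le> n" unfolding p_def by (intro degree_diff_le degree_monom_le) simp
  hence "degree p = n" using c by (metis coeff_eq_0 le_neq_implies_less zero_neq_one)
  hence "lead_coeff p = 1" using c by simp
  moreover have "poly (pderiv p) z \<noteq> 0" if "poly p z = 0" for z
  proof -
    have "z \<noteq> 0" using that n by (auto simp: p_def poly_monom power_0_left)
    thus ?thesis using assms by (simp add: p_def pderiv_diff pderiv_monom poly_monom)
  qed
  ultimately have "p = (\<Prod>z\<in>{z. poly p z = 0}. [:- z, 1:])"
    by (rule separable_eq_prod_roots)
  moreover have "{z. poly p z = 0} = {z. z ^ n = 1}" by (simp add: p_def poly_monom)
  ultimately show ?thesis by (simp only: p_def)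
qed

text \<open>The definition speaks about complex roots only. What carries over to other fields is the
  integer identity that X^n - 1 is the product of the cyclotomic polynomials of the divisors of n.
  By strong induction the factors of the proper divisors are known, and they cancel.\<close>

lemma map_poly_cyclotomic_int:
  assumes "of_nat n \<noteq> (0 :: 'b::alg_closed_field)"
  shows "map_poly of_int (cyclotomic_int n) =
    (\<Prod>z\<in>primitive_roots_of_unity n. [:- z, 1 :: 'b:])"
  using assms
proof (induction n rule: less_induct)
  case (less n)
  define C where "C k = (\<Prod>z\<in>primitive_roots_of_unity k. [:- z, 1 :: 'b:])" for k
  define D where "D = {k. k dvd n} - {n}"
  have n: "n > 0" using less.prems by (intro Nat.gr0I) auto
  have D: "finite D" "{k. k dvd n} = insert n D" "n \<notin> D"
    using n by (auto simp: D_def)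
  have lt: "k < n" "of_nat k \<noteq> (0 :: 'b)" if "k \<in> D" for k
    using that n less.prems by (auto simp: D_def intro: le_neq_implies_less dest: dvd_imp_le elim!: dvdE)
  have "map_poly of_int (cyclotomic_int n) * (\<Prod>k\<in>D. C k) =
      map_poly of_int (cyclotomic_int n) * (\<Prod>k\<in>D. map_poly of_int (cyclotomic_int k))"
    using less.IH lt by (simp add: C_def)
  also have "\<dots> = map_poly of_int (\<Prod>k\<in>{k. k dvd n}. cyclotomic_int k)"
    using D by (subst map_poly_prod_hom) simp_all
  also have "\<dots> = monom 1 n - 1"
    unfolding prod_dvd_cyclotomic_int[OF n] by (rule poly_eqI) (simp add: coeff_map_poly)
  also have "\<dots> = (\<Prod>z\<in>{z. z ^ n = 1}. [:- z, 1 :: 'b:])"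
    by (rule prod_roots_of_unity[OF less.prems])
  also have "\<dots> = (\<Prod>k\<in>insert n D. C k)"
    unfolding roots_of_unity_UN[OF n] C_def D(2)
    by (rule prod.UNION_disjoint)
      (use D in \<open>simp_all add: primitive_roots_disjoint finite_primitive_roots\<close>)
  also have "\<dots> = C n * (\<Prod>k\<in>D. C k)" using D by simp
  finally show ?case by (simp add: C_def prod_zero_iff[OF D(1)] prod_zero_iff[OF finite_primitive_roots])
qed

lemma map_poly_to_ac_cyclotomic:
  assumes "coprime n (CARD('a::{finite,field}))"
  shows "map_poly to_ac (cyclotomic n :: 'a poly) =
    (\<Prod>z\<in>primitive_roots_of_unity n. [:- z, 1:])"
proof -
  \<comment> \<open>An inverse of n modulo q is an inverse of n in the field, since q is 0 there; so
    n is nonzero in the field and X^n - 1 is separable. The congruence is written as an equation of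
    natural numbers to avoid subtraction.\<close>
  obtain m where "[n * m = 1] (mod CARD('a))" using cong_solve_coprime_nat[OF assms] by auto
  then obtain i j where ij: "1 + i * CARD('a) = n * m + j * CARD('a)"
    by (auto simp: cong_iff_lin_nat)
  have "of_nat (1 + i * CARD('a)) = (of_nat (n * m + j * CARD('a)) :: 'a)"
    by (simp only: ij)
  hence "of_nat n * of_nat m = (1 :: 'a)" by (simp add: of_nat_card_field)
  hence "of_nat n \<noteq> (0 :: 'a)" by auto
  hence "of_nat n \<noteq> (0 :: 'a alg_closure)" by (metis to_ac_eq_0_iff to_ac_of_nat)
  moreover have "map_poly to_ac (cyclotomic n :: 'a poly) = map_poly of_int (cyclotomic_int n)"
    unfolding cyclotomic_def by (subst map_poly_map_poly) (simp_all add: o_def)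
  ultimately show ?thesis using map_poly_cyclotomic_int by metis
qed

section \<open>Conjugates, irreducibility and a criterion for complete factorizations\<close>

lemma inj_on_conjugates:
  assumes "z \<in> primitive_roots_of_unity n" "coprime n q"
  shows "inj_on (\<lambda>j. z ^ q ^ j) {..<ord n q}"
proof (rule inj_onI)
  fix i j assume ij: "i \<in> {..<ord n q}" "j \<in> {..<ord n q}" "z ^ q ^ i = z ^ q ^ j"
  hence "[q ^ i = q ^ j] (mod n)" using primitive_root_power_eq_iff[OF assms(1)] by blast
  hence "[i = j] (mod ord n q)" using order_divides_expdiff[OF assms(2)] by blast
  thus "i = j" using ij by (simp add: cong_def)
qed

lemma conjugate_in_primitive_roots:
  assumes "z \<in> primitive_roots_of_unity n" "coprime n q"
  shows "z ^ q ^ j \<in> primitive_roots_of_unity n"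
  using assms by (intro primitive_root_power_coprime) (auto simp: coprime_commute)

lemma degree_ge_ord:
  fixes f :: "'a::{finite,field} poly"
  assumes "f \<noteq> 0" "poly (map_poly to_ac f) z = 0" "z \<in> primitive_roots_of_unity n"
    "coprime n CARD('a)"
  shows "ord n CARD('a) \<le> degree f"
proof -
  have f: "map_poly to_ac f \<noteq> 0" using assms(1) by (metis map_poly_0 map_poly_to_ac_eq_iff)
  have "ord n CARD('a) = card ((\<lambda>j. z ^ CARD('a) ^ j) ` {..<ord n CARD('a)})"
    using inj_on_conjugates[OF assms(3,4)] by (simp add: card_image)
  also have "\<dots> \<le> card {x. poly (map_poly to_ac f) x = 0}"
    using poly_root_conjugate[OF assms(2)] by (intro card_mono poly_roots_finite f) auto
  also have "\<dots> \<le> degree f" using card_poly_roots_bound[OF f] by simp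
  finally show ?thesis .
qed

text \<open>The leading terms cancel in f - g. A nonzero difference would vanish at z with a degree
  below the number of conjugates of z.\<close>

lemma monic_root_unique:
  fixes f g :: "'a::{finite,field} poly"
  assumes "lead_coeff f = 1" "degree f = ord n CARD('a)" "poly (map_poly to_ac f) z = 0"
    and "lead_coeff g = 1" "degree g = ord n CARD('a)" "poly (map_poly to_ac g) z = 0"
    and z: "z \<in> primitive_roots_of_unity n" "coprime n CARD('a)"
  shows "f = g"
proof (rule ccontr)
  assume "f \<noteq> g"
  have map: "map_poly to_ac (f - g) = map_poly to_ac f - map_poly to_ac g"
    by (rule poly_eqI) (simp add: coeff_map_poly)
  have "ord n CARD('a) \<le> degree (f - g)"
    using degree_ge_ord[OF _ _ z, of "f - g"] \<open>f \<noteq> g\<close> assms by (simp add: map)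
  moreover have "degree (f - g) \<le> ord n CARD('a)" using assms by (intro degree_diff_le) simp_all
  moreover have "coeff (f - g) (ord n CARD('a)) = 0" using assms by simp
  ultimately show False using \<open>f \<noteq> g\<close> by (metis eq_iff_diff_eq_0 leading_coeff_0_iff le_antisym)
qed

text \<open>One of two factors vanishes at z, hence already has the full degree, and the other one
  is constant.\<close>

lemma irreducible_if_degree_eq_ord:
  fixes f :: "'a::{finite,field} poly"
  assumes "degree f = ord n CARD('a)" "poly (map_poly to_ac f) z = 0" "f \<noteq> 0"
    and z: "z \<in> primitive_roots_of_unity n" "coprime n CARD('a)"
  shows "irreducible f"
proof (rule irreducibleI)
  have "n > 0" using z by (simp add: primitive_root_iff)
  hence pos: "ord n CARD('a) > 0" using z(2) by simp
  show "\<not> f dvd 1" using pos assms(1) assms(3) by (simp add: is_unit_iff_degree)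
  have *: "b dvd 1" if ab: "f = a * b" and a: "poly (map_poly to_ac a) z = 0" for a b
  proof -
    have "a \<noteq> 0" "b \<noteq> 0" using ab assms(3) by auto
    moreover have "ord n CARD('a) \<le> degree a" using degree_ge_ord[OF _ a z] \<open>a \<noteq> 0\<close> .
    ultimately have "degree b = 0" using ab assms(1) by (simp add: degree_mult_eq)
    thus ?thesis using \<open>b \<noteq> 0\<close> by (simp add: is_unit_iff_degree)
  qed
  fix a b assume ab: "f = a * b"
  hence "poly (map_poly to_ac a) z = 0 \<or> poly (map_poly to_ac b) z = 0"
    using assms(2) by (simp add: map_poly_to_ac_mult)
  thus "a dvd 1 \<or> b dvd 1" using *[OF ab] *[of b a] ab by (auto simp: mult.commute)
qed (rule assms(3))

lemma map_poly_to_ac_eq_prod_conjugates: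
  fixes f :: "'a::{finite,field} poly"
  assumes "lead_coeff f = 1" "degree f = ord n CARD('a)" "poly (map_poly to_ac f) z = 0"
    and z: "z \<in> primitive_roots_of_unity n" "coprime n CARD('a)"
  shows "map_poly to_ac f = (\<Prod>j<ord n CARD('a). [:- (z ^ CARD('a) ^ j), 1:])"
proof -
  have "map_poly to_ac f = (\<Prod>x\<in>(\<lambda>j. z ^ CARD('a) ^ j) ` {..<ord n CARD('a)}. [:- x, 1:])"
    using assms poly_root_conjugate[OF assms(3)] inj_on_conjugates[OF z]
    by (intro monic_eq_prod_roots) (auto simp: card_image coeff_map_poly)
  also have "\<dots> = (\<Prod>j<ord n CARD('a). [:- (z ^ CARD('a) ^ j), 1:])"
    by (subst prod.reindex[OF inj_on_conjugates[OF z]]) simp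
  finally show ?thesis .
qed

text \<open>The sets \<open>R f\<close> of primitive roots at which f vanishes are nonempty,
  disjoint for distinct f, and cover all primitive n-th roots. So the product over F regroups into
  the product of all linear factors. Finiteness of F comes out of the proof: R embeds F into the
  power set of a finite set.\<close>

lemma complete_factorization_cyclotomicI:
  fixes F :: "'a::{finite,field} poly set"
  assumes n: "n > 0" "coprime n CARD('a)"
    and monic: "\<And>f. f \<in> F \<Longrightarrow> lead_coeff f = 1"
    and degree: "\<And>f. f \<in> F \<Longrightarrow> degree f = ord n CARD('a)"
    and root: "\<And>f. f \<in> F \<Longrightarrow> \<exists>z\<in>primitive_roots_of_unity n. poly (map_poly to_ac f) z = 0"
    and cover: "\<And>z. z \<in> primitive_roots_of_unity n \<Longrightarrow> \<exists>f\<in>F. poly (map_poly to_ac f) z = 0"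
  shows "complete_factorization (cyclotomic n) F"
proof -
  define R where "R f = {z\<in>primitive_roots_of_unity n. poly (map_poly to_ac f) z = 0}"
    for f :: "'a poly"
  have finR: "finite (R f)" for f by (simp add: R_def finite_primitive_roots)
  have uniq: "f = g" if "f \<in> F" "g \<in> F" "z \<in> R f" "z \<in> R g" for f g z
    using that monic degree n by (intro monic_root_unique[of f n z g]) (auto simp: R_def)
  have nonempty: "R f \<noteq> {}" if "f \<in> F" for f using root[OF that] by (auto simp: R_def)
  have "inj_on R F"
  proof (rule inj_onI)
    fix f g assume fg: "f \<in> F" "g \<in> F" "R f = R g"
    obtain z where "z \<in> R f" using nonempty[OF fg(1)] by blast
    thus "f = g" using uniq[OF fg(1,2)] fg(3) by blast
  qed
  moreover have "R ` F \<subseteq> Pow (primitive_roots_of_unity n)" by (auto simp: R_def)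
  ultimately have finF: "finite F"
    by (meson finite_Pow_iff finite_imageD finite_primitive_roots finite_subset)
  have prodR: "map_poly to_ac f = (\<Prod>z\<in>R f. [:- z, 1:])" if f: "f \<in> F" for f
  proof -
    obtain z where z: "z \<in> primitive_roots_of_unity n" "poly (map_poly to_ac f) z = 0"
      using root[OF f] by blast
    have eq: "map_poly to_ac f = (\<Prod>j<ord n CARD('a). [:- (z ^ CARD('a) ^ j), 1:])"
      by (rule map_poly_to_ac_eq_prod_conjugates[OF monic[OF f] degree[OF f] z(2,1) n(2)])
    have "R f = (\<lambda>j. z ^ CARD('a) ^ j) ` {..<ord n CARD('a)}"
      using conjugate_in_primitive_roots[OF z(1) n(2)]
      by (auto simp: R_def eq poly_prod)
    thus ?thesis unfolding eq
      by (simp only: prod.reindex[OF inj_on_conjugates[OF z(1) n(2)]] o_def)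
  qed
  have "map_poly to_ac (\<Prod>f\<in>F. f) = (\<Prod>f\<in>F. map_poly to_ac f)"
    by (rule map_poly_prod_hom) simp_all
  also have "\<dots> = (\<Prod>f\<in>F. \<Prod>z\<in>R f. [:- z, 1:])" using prodR by simp
  also have "\<dots> = (\<Prod>z\<in>(\<Union>f\<in>F. R f). [:- z, 1:])"
    by (rule prod.UNION_disjoint[symmetric]) (use finF finR uniq in auto)
  also have "(\<Union>f\<in>F. R f) = primitive_roots_of_unity n" using cover by (auto simp: R_def)
  also have "(\<Prod>z\<in>primitive_roots_of_unity n. [:- z, 1:]) = map_poly to_ac (cyclotomic n :: 'a poly)"
    by (rule map_poly_to_ac_cyclotomic[OF n(2), symmetric])
  finally have "cyclotomic n = (\<Prod>f\<in>F. f)" by simp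
  moreover have "irreducible f" if "f \<in> F" for f
    using root[OF that] degree[OF that] monic[OF that] n(2)
    by (metis irreducible_if_degree_eq_ord leading_coeff_0_iff zero_neq_one)
  ultimately show ?thesis using finF by (simp add: complete_factorization_def)
qed

section \<open>Polynomials in x^M and the recurrence as a reflection identity\<close>

text \<open>The common shape of all factors: coefficients are listed from the leading one downwards,
  and M substitutes x^M for x. The value M = 2 serves the recurrence, M = 2^k the factors of higher
  degree.\<close>

definition stretch :: "nat \<Rightarrow> nat \<Rightarrow> (nat \<Rightarrow> 'b::comm_ring_1) \<Rightarrow> 'b poly" where
  "stretch d M c = (\<Sum>i=0..d. monom (c i) (M * (d - i)))"

lemma stretch_cong: "(\<And>i. i \<le> d \<Longrightarrow> a i = b i) \<Longrightarrow> stretch d M a = stretch d M b"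
  unfolding stretch_def by (intro sum.cong) auto

lemma coeff_stretch:
  assumes "M > 0" "i \<le> d"
  shows "coeff (stretch d M c) (M * (d - i)) = c i"
proof -
  have "coeff (stretch d M c) (M * (d - i)) = (\<Sum>j=0..d. if j = i then c j else 0)"
    unfolding stretch_def coeff_sum using assms by (intro sum.cong) auto
  thus ?thesis using assms by simp
qed

lemma stretch_eq_iff: "stretch d 1 a = stretch d 1 b \<longleftrightarrow> (\<forall>i\<le>d. a i = b i)"
proof
  show "\<forall>i\<le>d. a i = b i" if "stretch d 1 a = stretch d 1 b"
    using that coeff_stretch[of 1 _ d a] coeff_stretch[of 1 _ d b] by auto
qed (intro stretch_cong, simp)

lemma degree_stretch_le: "degree (stretch d M c) \<le> M * d"
  unfolding stretch_def
  by (intro degree_sum_le) (auto intro!: order_trans[OF degree_monom_le])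

lemma degree_stretch:
  assumes "M > 0" "c 0 = 1"
  shows "degree (stretch d M c) = M * d"
proof (rule antisym[OF degree_stretch_le])
  show "M * d \<le> degree (stretch d M c)"
    using coeff_stretch[of M 0 d c] assms by (intro le_degree) auto
qed

lemma lead_coeff_stretch:
  assumes "M > 0" "c 0 = 1"
  shows "lead_coeff (stretch d M c) = 1"
  using coeff_stretch[of M 0 d c] assms by (simp add: degree_stretch)

lemma poly_stretch: "poly (stretch d M c) z = poly (stretch d 1 c) (z ^ M)"
  by (simp add: stretch_def poly_sum poly_monom flip: power_mult)

lemma pcompose_stretch:
  fixes c :: "nat \<Rightarrow> 'b::comm_ring_1"
  shows "pcompose (stretch d 1 c) (monom 1 M) = stretch d M c"
proof -
  have "pcompose (monom a k) (monom 1 M) = monom a (M * k)" for a :: 'b and k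
    by (simp add: pcompose_altdef map_poly_monom poly_monom monom_power smult_monom
        mult.commute)
  thus ?thesis by (simp add: stretch_def pcompose_sum)
qed

lemma map_poly_to_ac_stretch: "map_poly to_ac (stretch d M c) = stretch d M (\<lambda>i. to_ac (c i))"
  by (rule poly_eqI) (simp add: stretch_def coeff_map_poly coeff_sum to_ac_sum if_distrib[of to_ac] cong: if_cong)

lemma coeff_stretch_mult:
  assumes "s \<le> 2 * d"
  shows "coeff (stretch d 1 a * stretch d 1 b) (2 * d - s) =
    (\<Sum>(i, j)\<in>{(i, j). i \<le> d \<and> j \<le> d \<and> i + j = s}. a i * b j)"
proof -
  have "stretch d 1 a * stretch d 1 b =
      (\<Sum>(i, j)\<in>{0..d} \<times> {0..d}. monom (a i * b j) ((d - i) + (d - j)))"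
    by (simp only: stretch_def sum_product sum.cartesian_product mult_monom mult_1)
  hence "coeff (stretch d 1 a * stretch d 1 b) (2 * d - s) =
      (\<Sum>(i, j)\<in>{0..d} \<times> {0..d}. if i + j = s then a i * b j else 0)"
    using assms by (auto simp: coeff_sum intro!: sum.cong)
  also have "\<dots> = (\<Sum>(i, j)\<in>{(i, j). i \<le> d \<and> j \<le> d \<and> i + j = s}. a i * b j)"
    by (rule sum.mono_neutral_cong_right) (auto split: if_splits)
  finally show ?thesis .
qed

text \<open>With f = \<open>stretch d 1 a\<close> the second factor is (-1)^d f(-x), so the product
  is an even polynomial. Its coefficient at x^(2d-2k) is the sum in the recurrence, and for k = 0
  both sides are 1. The d equations are therefore the whole identity.\<close>

lemma recurrence_iff_mult_reflection:
  fixes a b :: "nat \<Rightarrow> 'b::field"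
  assumes "(2 :: 'b) \<noteq> 0" "a 0 = 1" "b 0 = 1"
  shows "(\<forall>k\<in>{1..d}. (\<Sum>(i, j)\<in>{(i, j). i \<le> d \<and> j \<le> d \<and> i + j = 2 * k}.
            (-1) ^ j * a i * a j) = b k) \<longleftrightarrow>
    stretch d 1 a * stretch d 1 (\<lambda>j. (-1) ^ j * a j) = stretch d 2 b"
proof -
  define I where "I s = {(i, j). i \<le> d \<and> j \<le> d \<and> i + j = s}" for s :: nat
  define c where "c s = (\<Sum>(i, j)\<in>I s. (-1) ^ j * a i * a j)" for s
  define P where "P = stretch d 1 a * stretch d 1 (\<lambda>j. (-1) ^ j * a j)"
  have coeffP: "coeff P (2 * d - s) = c s" if "s \<le> 2 * d" for s
    unfolding P_def coeff_stretch_mult[OF that] c_def I_def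
    by (intro sum.cong) (auto simp: mult_ac)
  have c0: "c 0 = b 0"
  proof -
    have "I 0 = {(0, 0)}" by (auto simp: I_def)
    thus ?thesis using assms by (simp add: c_def)
  qed
  \<comment> \<open>Exchanging i and j negates the sum when i + j is odd, and 2 \<noteq> 0 forces it
    to vanish.\<close>
  have odd: "c s = 0" if "odd s" for s
  proof -
    have "c s = (\<Sum>(i, j)\<in>I s. (-1) ^ i * a j * a i)" unfolding c_def
      by (rule sum.reindex_bij_witness[of _ prod.swap prod.swap]) (auto simp: I_def)
    also have "\<dots> = (\<Sum>(i, j)\<in>I s. - ((-1) ^ j * a i * a j))"
      using that by (intro sum.cong) (auto simp: I_def minus_one_power_iff)
    also have "\<dots> = - c s" by (simp add: c_def sum_negf split_def)
    finally have "2 * c s = 0" by (metis add.right_inverse mult_2)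
    thus ?thesis using assms(1) by simp
  qed
  have even: "coeff (stretch d 2 b) (2 * d - 2 * k) = b k" if "k \<le> d" for k
    using coeff_stretch[of 2 k d b] that by (simp add: diff_mult_distrib2)
  have odd': "coeff (stretch d 2 b) n = 0" if "odd n" for n
    using that by (auto simp: stretch_def coeff_sum intro!: sum.neutral)
  have "P = stretch d 2 b \<longleftrightarrow> (\<forall>k\<in>{1..d}. c (2 * k) = b k)"
  proof
    assume eq: "P = stretch d 2 b"
    show "\<forall>k\<in>{1..d}. c (2 * k) = b k"
      using coeffP[of "2 * _"] even unfolding eq by auto
  next
    assume ck: "\<forall>k\<in>{1..d}. c (2 * k) = b k"
    show "P = stretch d 2 b"
    proof (rule poly_eqI)
      fix n
      show "coeff P n = coeff (stretch d 2 b) n"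
      proof (cases "n \<le> 2 * d")
        case False
        have "degree P \<le> 1 * d + 1 * d" unfolding P_def
          by (intro order_trans[OF degree_mult_le] add_mono degree_stretch_le)
        thus ?thesis using False degree_stretch_le[of d 2 b] by (simp add: coeff_eq_0)
      next
        case True
        define s where "s = 2 * d - n"
        have n: "n = 2 * d - s" "s \<le> 2 * d" using True by (auto simp: s_def)
        show ?thesis
        proof (cases "even s")
          case False
          hence "odd n" using n by simp
          thus ?thesis using coeffP[OF n(2)] odd[OF False] odd' n(1) by simp
        next
          case True
          then obtain k where k: "s = 2 * k" "k \<le> d" using n(2) by (auto elim!: evenE)
          have "c (2 * k) = b k" using ck c0 k(2) by (cases "k = 0") auto
          thus ?thesis using coeffP[OF n(2)] even[OF k(2)] by (simp add: n(1) k(1))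
        qed
      qed
    qed
  qed
  thus ?thesis by (simp only: P_def c_def I_def)
qed

section \<open>Elementary symmetric polynomials of the conjugates\<close>

lemma elem_sym_0 [simp]: "elem_sym d 0 x = 1"
proof -
  have "{J. J \<subseteq> {..<d} \<and> card J = 0} = {{}}"
    by (auto dest: finite_subset[OF _ finite_lessThan])
  thus ?thesis by (simp add: elem_sym_def)
qed

lemma elem_sym_scale: "elem_sym d i (\<lambda>j. v * x j) = v ^ i * elem_sym d i x"
  by (auto simp: elem_sym_def sum_distrib_left prod.distrib intro!: sum.cong)

text \<open>Vieta with plus signs: expanding the product chooses a set J of constant terms, and sets
  of equal size are grouped. The roots are the \<open>- x j\<close>, which is why later statements
  put the condition on the order on \<open>- y\<close>.\<close>

lemma prod_eq_stretch_elem_sym: "(\<Prod>j<d. [:x j, 1:]) = stretch d 1 (\<lambda>i. elem_sym d i x)"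
proof -
  have "(\<Prod>j<d. [:x j, 1:]) = (\<Prod>j<d. [:x j:] + monom 1 1)"
    by (simp add: monom_altdef)
  also have "\<dots> = (\<Sum>J\<in>Pow {..<d}. (\<Prod>j\<in>J. [:x j:]) * (\<Prod>j\<in>{..<d} - J. monom 1 1))"
    by (rule prod_add) simp
  also have "\<dots> = (\<Sum>J\<in>Pow {..<d}. monom (\<Prod>j\<in>J. x j) (d - card J))"
  proof (rule sum.cong)
    fix J assume "J \<in> Pow {..<d}"
    hence J: "J \<subseteq> {..<d}" "finite J" by (auto dest: finite_subset[OF _ finite_lessThan])
    have "(\<Prod>j\<in>J. [:x j:]) = monom (\<Prod>j\<in>J. x j) 0"
      using J(2) by induction (simp_all add: monom_0 one_pCons)
    thus "(\<Prod>j\<in>J. [:x j:]) * (\<Prod>j\<in>{..<d} - J. monom 1 1) = monom (\<Prod>j\<in>J. x j) (d - card J)"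
      using J by (simp add: card_Diff_subset monom_power mult_monom)
  qed simp
  also have "\<dots> = (\<Sum>i\<in>{0..d}. \<Sum>J\<in>{J\<in>Pow {..<d}. card J = i}. monom (\<Prod>j\<in>J. x j) (d - card J))"
    using card_mono[of "{..<d}"] by (intro sum.group[symmetric]) auto
  also have "\<dots> = stretch d 1 (\<lambda>i. elem_sym d i x)"
    unfolding stretch_def elem_sym_def monom_sum by (intro sum.cong) auto
  finally show ?thesis .
qed

lemma prod_conjugates_eq_stretch:
  "(\<Prod>j<d. [:y ^ q ^ j, 1:]) = stretch d 1 (\<lambda>i. conj_sym q d i y)"
  unfolding conj_sym_def by (rule prod_eq_stretch_elem_sym)

lemma conj_sym_0 [simp]: "conj_sym q d 0 y = 1"
  by (simp add: conj_sym_def)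

text \<open>As v is fixed by the q-th power, the conjugates of v w are v w^(q^j), and homogeneity of
  degree i extracts v^i.\<close>

lemma conj_sym_mult:
  assumes "v ^ q = v"
  shows "conj_sym q d i (v * w) = v ^ i * conj_sym q d i w"
proof -
  have "v ^ q ^ j = v" for j by (induction j) (simp_all add: assms power_mult)
  thus ?thesis by (simp add: conj_sym_def power_mult_distrib elem_sym_scale)
qed

lemma conj_sym_uminus:
  "conj_sym CARD('a) d i (- y) = (-1) ^ i * conj_sym CARD('a) d i (y :: 'a::{finite,field} alg_closure)"
  using conj_sym_mult[of "-1" "CARD('a)" d i y] by (simp add: power_card_uminus)

text \<open>The Frobenius map sends the linear factor of index j to that of index j + 1, and y^(q^d)
  = y closes the cycle. The product is unchanged, so its coefficients are fixed by the Frobenius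
  map.\<close>

lemma conj_sym_in_range_to_ac:
  fixes y :: "'a::{finite,field} alg_closure"
  assumes "y ^ CARD('a) ^ d = y"
  shows "conj_sym CARD('a) d i y \<in> range to_ac"
proof (cases "i \<le> d")
  case False
  have "{J. J \<subseteq> {..<d} \<and> card J = i} = {}"
    using False card_mono[of "{..<d}"] by fastforce
  hence "conj_sym CARD('a) d i y = to_ac 0" unfolding conj_sym_def elem_sym_def by (simp only: sum.empty to_ac_0)
  thus ?thesis by blast
next
  case True
  define \<phi> where "\<phi> x = x ^ CARD('a)" for x :: "'a alg_closure"
  define g where "g j = [:y ^ CARD('a) ^ j, 1:]" for j
  define P where "P = (\<Prod>j<d. g j)"
  have \<phi>: "\<phi> 0 = 0" "\<phi> 1 = 1" "\<phi> (x + y) = \<phi> x + \<phi> y" "\<phi> (x * y) = \<phi> x * \<phi> y" for x y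
    using card_field_gt_1[where 'a = 'a]
    by (simp_all add: \<phi>_def power_card_add power_mult_distrib power_0_left)
  have "map_poly \<phi> P = (\<Prod>j<d. map_poly \<phi> (g j))"
    unfolding P_def by (rule map_poly_prod_hom) (simp_all add: \<phi>)
  also have "\<dots> = (\<Prod>j<d. g (Suc j))"
    by (simp add: g_def map_poly_pCons \<phi> \<phi>_def mult.commute[of "CARD('a)"] flip: power_mult)
  also have "\<dots> = P"
  proof -
    \<comment> \<open>Both sides are the product over the indices 0 to d; cancelling g 0 = g d shows
      that the shifted product is P.\<close>
    have "g 0 * (\<Prod>j<d. g (Suc j)) = P * g d"
      unfolding P_def by (metis prod.lessThan_Suc prod.lessThan_Suc_shift)
    moreover have "g d = g 0" "g 0 \<noteq> 0" using assms by (simp_all add: g_def)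
    ultimately show ?thesis by simp
  qed
  finally have "coeff (map_poly \<phi> P) (d - i) = coeff P (d - i)" by simp
  moreover have "coeff P (d - i) = conj_sym CARD('a) d i y"
    using coeff_stretch[of 1 i d] True by (simp add: P_def g_def prod_conjugates_eq_stretch)
  ultimately have "conj_sym CARD('a) d i y ^ CARD('a) = conj_sym CARD('a) d i y"
    by (simp add: coeff_map_poly \<phi>(1)) (simp add: \<phi>_def)
  thus ?thesis by (rule power_card_eq_self_imp_range_to_ac)
qed

text \<open>For y_j = y^(q^j) the linear factors pair up as (x + y_j)(x - y_j) = x^2 - y_j^2. The
  sign in - (y^2) comes from the plus-sign form of Vieta.\<close>

lemma conjugates_mult_reflection:
  fixes y :: "'a::{finite,field} alg_closure"
  shows "stretch d 1 (\<lambda>i. conj_sym CARD('a) d i y) *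
      stretch d 1 (\<lambda>i. (-1) ^ i * conj_sym CARD('a) d i y) =
    stretch d 2 (\<lambda>i. conj_sym CARD('a) d i (- (y ^ 2)))"
proof -
  have "pcompose [:c, 1:] (monom 1 2) = [:c, 0, 1 :: 'a alg_closure:]" for c
    by (simp add: pcompose_pCons monom_altdef power2_eq_square)
  hence "stretch d 2 (\<lambda>i. conj_sym CARD('a) d i (- (y ^ 2))) =
      (\<Prod>j<d. [:(- (y ^ 2)) ^ CARD('a) ^ j, 0, 1:])"
    by (simp only: pcompose_stretch[of d _ 2, symmetric] prod_conjugates_eq_stretch[symmetric] pcompose_prod)
  also have "\<dots> = (\<Prod>j<d. [:y ^ CARD('a) ^ j, 1:] * [:(- y) ^ CARD('a) ^ j, 1:])"
    by (intro prod.cong refl)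
      (simp add: power_card_power_uminus mult.commute[of 2] power2_eq_square power_mult_distrib)
  also have "\<dots> = (\<Prod>j<d. [:y ^ CARD('a) ^ j, 1:]) * (\<Prod>j<d. [:(- y) ^ CARD('a) ^ j, 1:])"
    by (rule prod.distrib)
  also have "\<dots> = stretch d 1 (\<lambda>i. conj_sym CARD('a) d i y) *
      stretch d 1 (\<lambda>i. (-1) ^ i * conj_sym CARD('a) d i y)"
    by (simp add: prod_conjugates_eq_stretch conj_sym_uminus)
  finally show ?thesis by simp
qed

lemma power_card_ord_eq_self:
  assumes "z \<in> primitive_roots_of_unity n"
  shows "z ^ q ^ ord n q = z"
  using primitive_root_power_eq_iff[OF assms, of "q ^ ord n q" 1] ord[of q n] by simp

lemma conj_sym_in_range_to_ac_if_ord: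
  fixes y :: "'a::{finite,field} alg_closure"
  assumes "- y \<in> primitive_roots_of_unity n" "ord n CARD('a) = d"
  shows "conj_sym CARD('a) d i y \<in> range to_ac"
  using power_card_ord_eq_self[OF assms(1), of "CARD('a)"] assms(2)
  by (intro conj_sym_in_range_to_ac) (simp add: power_card_power_uminus)

section \<open>Complete factorizations through symmetric functions of conjugates\<close>

text \<open>The polynomial attached to y vanishes exactly at the 2^k-th roots of the conjugates of
  \<open>- y\<close>. These have order 2^k n since n is even or k = 0, and by hypothesis the degree
  2^k d is the order of q modulo 2^k n.\<close>

lemma complete_factorization_stretch:
  fixes n k d :: nat
  defines "d \<equiv> ord n (CARD('a::{finite,field}))"
  assumes n: "n > 0" "coprime n CARD('a)" "odd CARD('a)" "k = 0 \<or> even n"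
    and ord: "ord (2 ^ k * n) CARD('a) = 2 ^ k * d"
  shows "complete_factorization (cyclotomic (2 ^ k * n))
    (stretch d (2 ^ k) ` {c :: nat \<Rightarrow> 'a.
      \<exists>y. - y \<in> primitive_roots_of_unity n \<and> (\<forall>i\<le>d. to_ac (c i) = conj_sym CARD('a) d i y)})"
    (is "complete_factorization _ (_ ` ?C)")
proof (rule complete_factorization_cyclotomicI)
  have od: "ord n CARD('a) = d" by (simp only: d_def)
  have d: "d > 0" using n by (simp add: d_def)
  have roots: "poly (map_poly to_ac (stretch d (2 ^ k) c)) z = (\<Prod>j<d. z ^ 2 ^ k + y ^ CARD('a) ^ j)"
    if "\<forall>i\<le>d. to_ac (c i) = conj_sym CARD('a) d i y" for c :: "nat \<Rightarrow> 'a" and y z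
  proof -
    have "poly (map_poly to_ac (stretch d (2 ^ k) c)) z = poly (stretch d 1 (\<lambda>i. to_ac (c i))) (z ^ 2 ^ k)"
      by (simp only: map_poly_to_ac_stretch poly_stretch[of d "2 ^ k"])
    also have "stretch d 1 (\<lambda>i. to_ac (c i)) = (\<Prod>j<d. [:y ^ CARD('a) ^ j, 1:])"
      unfolding prod_conjugates_eq_stretch using that by (intro stretch_cong) simp
    finally show ?thesis by (simp add: poly_prod add.commute)
  qed
  have c0: "c 0 = 1" if "c \<in> ?C" for c
  proof -
    have "to_ac (c 0) = 1" using that by auto
    thus ?thesis by simp
  qed
  show "2 ^ k * n > 0" "coprime (2 ^ k * n) CARD('a)" using n by simp_all
  show "lead_coeff f = 1" "degree f = ord (2 ^ k * n) CARD('a)" if f: "f \<in> stretch d (2 ^ k) ` ?C" for f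
  proof -
    obtain c where c: "f = stretch d (2 ^ k) c" "c \<in> ?C" using f by blast
    show "lead_coeff f = 1" "degree f = ord (2 ^ k * n) CARD('a)"
      using lead_coeff_stretch[of "2 ^ k" c d] degree_stretch[of "2 ^ k" c d] c0[OF c(2)] ord
      by (simp_all add: c(1))
  qed
  show "\<exists>z\<in>primitive_roots_of_unity (2 ^ k * n). poly (map_poly to_ac f) z = 0"
    if f: "f \<in> stretch d (2 ^ k) ` ?C" for f
  proof -
    obtain c y where c: "f = stretch d (2 ^ k) c" "- y \<in> primitive_roots_of_unity n"
      "\<forall>i\<le>d. to_ac (c i) = conj_sym CARD('a) d i y" using f by auto
    obtain z where z: "z ^ 2 ^ k = - y" using nth_root_exists[of "2 ^ k" "- y"] by auto
    have "z \<in> primitive_roots_of_unity (2 ^ k * n)"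
      using c(2) primitive_root_power_two_iff[OF n(4), of z] by (simp add: z)
    moreover have "poly (map_poly to_ac f) z = 0"
      unfolding c(1) roots[OF c(3)] z using d by (intro prod_zero bexI[of _ 0]) auto
    ultimately show ?thesis by blast
  qed
  show "\<exists>f\<in>stretch d (2 ^ k) ` ?C. poly (map_poly to_ac f) z = 0"
    if z: "z \<in> primitive_roots_of_unity (2 ^ k * n)" for z
  proof -
    define y where "y = - (z ^ 2 ^ k)"
    have y: "- y \<in> primitive_roots_of_unity n"
      unfolding y_def using primitive_root_power_mult[OF z] by simp
    have "\<forall>i. \<exists>c. to_ac c = conj_sym CARD('a) d i y"
      using conj_sym_in_range_to_ac_if_ord[OF y od] by (metis rangeE)
    then obtain c where c: "\<And>i. to_ac (c i) = conj_sym CARD('a) d i y" by metis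
    hence "poly (map_poly to_ac (stretch d (2 ^ k) c)) z = 0"
      using d roots[of c y z] by (auto intro!: prod_zero bexI[of _ 0] simp: y_def)
    thus ?thesis using c y by blast
  qed
qed

text \<open>The same set of factors with coefficients written in the closure: the d-th power of the
  Frobenius map fixes y, so the symmetric functions come from the base field.\<close>

lemma complete_factorization_ac_stretch:
  fixes n k d :: nat
  defines "d \<equiv> ord n (CARD('a::{finite,field}))"
  assumes n: "n > 0" "coprime n CARD('a)" "odd CARD('a)" "k = 0 \<or> even n"
    and ord: "ord (2 ^ k * n) CARD('a) = 2 ^ k * d"
  shows "complete_factorization_ac (cyclotomic (2 ^ k * n) :: 'a poly)
    {stretch d (2 ^ k) (\<lambda>i. conj_sym CARD('a) d i y) | y. - y \<in> primitive_roots_of_unity n}"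
    (is "complete_factorization_ac _ ?P")
proof -
  have od: "ord n CARD('a) = d" by (simp only: d_def)
  define C where "C = {c :: nat \<Rightarrow> 'a.
    \<exists>y. - y \<in> primitive_roots_of_unity n \<and> (\<forall>i\<le>d. to_ac (c i) = conj_sym CARD('a) d i y)}"
  have "map_poly to_ac ` stretch d (2 ^ k) ` C = ?P"
  proof (intro equalityI subsetI)
    fix p assume "p \<in> map_poly to_ac ` stretch d (2 ^ k) ` C"
    then obtain c y where "p = map_poly to_ac (stretch d (2 ^ k) c)"
        "- y \<in> primitive_roots_of_unity n" "\<forall>i\<le>d. to_ac (c i) = conj_sym CARD('a) d i y"
      by (auto simp: C_def)
    thus "p \<in> ?P" by (auto simp: map_poly_to_ac_stretch intro!: exI[of _ y] stretch_cong)
  next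
    fix p assume "p \<in> ?P"
    then obtain y where y: "p = stretch d (2 ^ k) (\<lambda>i. conj_sym CARD('a) d i y)"
        "- y \<in> primitive_roots_of_unity n"
      by blast
    have "\<forall>i. \<exists>c. to_ac c = conj_sym CARD('a) d i y"
      using conj_sym_in_range_to_ac_if_ord[OF y(2) od] by (metis rangeE)
    then obtain c where c: "\<And>i. to_ac (c i) = conj_sym CARD('a) d i y" by metis
    hence "c \<in> C" "p = map_poly to_ac (stretch d (2 ^ k) c)"
      using y by (auto simp: C_def map_poly_to_ac_stretch)
    thus "p \<in> map_poly to_ac ` stretch d (2 ^ k) ` C" by blast
  qed
  thus ?thesis using complete_factorization_stretch[where 'a = 'a and n = n and k = k] n ord
    unfolding complete_factorization_ac_def C_def d_def by blast
qed

text \<open>Split y = v w, where \<open>- v\<close> and w have orders 2^l and r. Since 2^l divides q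
  - 1, v is fixed by the q-th power and leaves the symmetric functions as v^i.\<close>

lemma stretch_conj_sym_primitive_root_mult:
  fixes q l r d M :: nat
  assumes "[q = 1] (mod 2 ^ l)" "odd r" "l > 0"
    and uminus: "\<And>u :: 'a::{finite,field} alg_closure. (- u) ^ q = - (u ^ q)"
  shows "{stretch d M (\<lambda>i. conj_sym q d i y) | y :: 'a alg_closure. - y \<in> primitive_roots_of_unity (2 ^ l * r)} =
    {stretch d M (\<lambda>i. v ^ i * conj_sym q d i w) | v w.
      - v \<in> primitive_roots_of_unity (2 ^ l) \<and> w \<in> primitive_roots_of_unity r}"
    (is "?P = ?Q")
proof (intro equalityI subsetI)
  have fixed: "v ^ q = v" if "- v \<in> primitive_roots_of_unity (2 ^ l)" for v :: "'a alg_closure"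
    using primitive_root_power_eq_iff[OF that, of q 1] assms(1) by (simp add: uminus)
  have co: "coprime (2 ^ l) r" using assms(2) by simp
  show "p \<in> ?P" if p: "p \<in> ?Q" for p
  proof -
    obtain v w where vw: "p = stretch d M (\<lambda>i. v ^ i * conj_sym q d i w)"
      "- v \<in> primitive_roots_of_unity (2 ^ l)" "w \<in> primitive_roots_of_unity r"
      using p by blast
    have "- (v * w) \<in> primitive_roots_of_unity (2 ^ l * r)"
      using primitive_root_mult[OF vw(2,3) co] by simp
    moreover have "p = stretch d M (\<lambda>i. conj_sym q d i (v * w))"
      by (simp only: vw(1) conj_sym_mult[OF fixed[OF vw(2)]])
    ultimately show ?thesis by blast
  qed
  show "p \<in> ?Q" if p: "p \<in> ?P" for p
  proof -
    obtain y where y: "p = stretch d M (\<lambda>i. conj_sym q d i y)"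
      "- y \<in> primitive_roots_of_unity (2 ^ l * r)"
      using p by blast
    obtain u w where uw: "u \<in> primitive_roots_of_unity (2 ^ l)" "w \<in> primitive_roots_of_unity r"
      "- y = u * w"
      using primitive_root_decompose[OF y(2) co] .
    have u: "- (- u) \<in> primitive_roots_of_unity (2 ^ l)" using uw(1) by simp
    have "y = (- u) * w" using uw(3) by (metis minus_mult_left minus_minus)
    hence "p = stretch d M (\<lambda>i. (- u) ^ i * conj_sym q d i w)"
      using y(1) conj_sym_mult[OF fixed[OF u]] by simp
    thus ?thesis using u uw(2) by blast
  qed
qed

section \<open>Solutions of the recurrence as coefficient tuples\<close>

text \<open>Rules out that a solution at level A arises from the rule \<open>step\<close>.\<close>

lemma recurrence_solution_level_ge: "recurrence_solution q d A u w n a \<Longrightarrow> A \<le> n"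
  by (induction rule: recurrence_solution.induct) auto

text \<open>Induction on the level. The order of q modulo 2^k r stays d from level A to level n, so
  each factor has degree d and is determined by any one of its roots. One step of the recurrence
  replaces a root by one of its square roots.\<close>

lemma recurrence_solution_iff_conj_sym:
  fixes a :: "nat \<Rightarrow> 'a::{finite,field}"
  defines "q \<equiv> CARD('a)"
  assumes A: "A \<ge> 2" "[q = 1] (mod 2 ^ A)" and r: "odd r" "coprime r q"
    and ord: "\<And>k. A \<le> k \<Longrightarrow> k \<le> n \<Longrightarrow> ord (2 ^ k * r) q = d"
    and n: "A \<le> n"
  shows "(\<exists>u w. u \<in> primitive_roots_of_unity (2 ^ A) \<and> w \<in> primitive_roots_of_unity r \<and>
      recurrence_solution q d A u w n a) \<longleftrightarrow>
    (\<exists>y. - y \<in> primitive_roots_of_unity (2 ^ n * r) \<and> (\<forall>i\<le>d. to_ac (a i) = conj_sym q d i y))"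
  using n ord
proof (induction n arbitrary: a rule: dec_induct)
  case base
  have four: "4 dvd (2 :: nat) ^ A" using A(1) le_imp_power_dvd[of 2 A "2 :: nat"] by simp
  have co: "coprime (2 ^ A) r" using r by simp
  have fixed: "v ^ q = v" if "v \<in> primitive_roots_of_unity (2 ^ A)" for v :: "'a alg_closure"
    using primitive_root_power_eq_iff[OF that, of q 1] A(2) by simp
  show ?case
  proof
    assume "\<exists>u w. u \<in> primitive_roots_of_unity (2 ^ A) \<and> w \<in> primitive_roots_of_unity r \<and>
      recurrence_solution q d A u w A a"
    then obtain u w where uw: "u \<in> primitive_roots_of_unity (2 ^ A)" "w \<in> primitive_roots_of_unity r"
      "recurrence_solution q d A u w A a" by blast
    have a: "a 0 = 1 \<and> (\<forall>k\<in>{1..d}. to_ac (a k) = u ^ k * conj_sym q d k w)"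
      using uw(3) by cases (auto dest: recurrence_solution_level_ge)
    have "to_ac (a i) = conj_sym q d i (u * w)" if "i \<le> d" for i
      unfolding conj_sym_mult[OF fixed[OF uw(1)]] using a that by (cases "i = 0") auto
    moreover have "- (u * w) \<in> primitive_roots_of_unity (2 ^ A * r)"
      using primitive_root_mult[OF primitive_root_uminus[OF uw(1) four] uw(2) co] by simp
    ultimately show "\<exists>y. - y \<in> primitive_roots_of_unity (2 ^ A * r) \<and>
        (\<forall>i\<le>d. to_ac (a i) = conj_sym q d i y)"
      by blast
  next
    assume "\<exists>y. - y \<in> primitive_roots_of_unity (2 ^ A * r) \<and>
        (\<forall>i\<le>d. to_ac (a i) = conj_sym q d i y)"
    then obtain y where y: "- y \<in> primitive_roots_of_unity (2 ^ A * r)"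
      "\<forall>i\<le>d. to_ac (a i) = conj_sym q d i y" by blast
    obtain u w where uw: "u \<in> primitive_roots_of_unity (2 ^ A)" "w \<in> primitive_roots_of_unity r"
      "- y = u * w"
      using primitive_root_decompose[OF y(1) co] .
    \<comment> \<open>As 4 divides 2^A, the sign of y = (-u) w is absorbed into the initial
      value.\<close>
    have u: "- u \<in> primitive_roots_of_unity (2 ^ A)" by (rule primitive_root_uminus[OF uw(1) four])
    have yu: "y = (- u) * w" using uw(3) by (metis minus_mult_left minus_minus)
    have "to_ac (a 0) = 1" using y(2) by simp
    hence "recurrence_solution q d A (- u) w A a"
      using y(2) unfolding yu conj_sym_mult[OF fixed[OF u]]
      by (intro recurrence_solution.initial) auto
    thus "\<exists>u w. u \<in> primitive_roots_of_unity (2 ^ A) \<and> w \<in> primitive_roots_of_unity r \<and>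
      recurrence_solution q d A u w A a"
      using u uw(2) by blast
  qed
next
  case (step n)
  have A0: "even (2 ^ n * r)" using A(1) step.hyps by simp
  have oddq: "odd q"
  proof -
    have "[q = 1] (mod 2)"
      using A by (intro cong_dvd_modulus_nat[OF A(2)]) (simp add: dvd_power)
    thus ?thesis by (simp add: cong_def odd_iff_mod_2_eq_one)
  qed
  \<comment> \<open>If 2 were 0, the odd number q would be 1 in the field, but it is 0
    there.\<close>
  have two: "(2 :: 'a alg_closure) \<noteq> 0"
  proof
    assume "(2 :: 'a alg_closure) = 0"
    hence "of_nat q = (1 :: 'a alg_closure)"
      using oddq by (auto elim!: oddE)
    thus False using of_nat_card_field[where 'a = 'a] unfolding q_def
      by (metis to_ac_0 to_ac_of_nat zero_neq_one)
  qed
  have ordn: "ord (2 ^ n * r) q = d" "ord (2 * (2 ^ n * r)) q = d"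
    using step.prems[of n] step.prems[of "Suc n"] step.hyps by (simp_all add: mult.assoc)
  have co: "coprime (2 ^ n * r) q" "coprime (2 * (2 ^ n * r)) q" using r oddq by simp_all
  have d: "d > 0" using ordn(1) co(1) by (metis ord_gt_0_iff)
  \<comment> \<open>The recurrence is an equation over the base field, the reflection identity one
    over the closure; injectivity of \<open>to_ac\<close> connects them.\<close>
  have transfer: "(\<forall>k\<in>{1..d}. (\<Sum>(i, j)\<in>{(i, j). i \<le> d \<and> j \<le> d \<and> i + j = 2 * k}.
            (-1) ^ j * a i * a j) = b k) \<longleftrightarrow>
    stretch d 1 (\<lambda>i. to_ac (a i)) * stretch d 1 (\<lambda>j. (-1) ^ j * to_ac (a j)) =
      stretch d 2 (\<lambda>i. to_ac (b i))" if "a 0 = 1" "b 0 = 1" for a b :: "nat \<Rightarrow> 'a"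
  proof -
    have "(\<Sum>(i, j)\<in>{(i, j). i \<le> d \<and> j \<le> d \<and> i + j = 2 * k}. (-1) ^ j * to_ac (a i) * to_ac (a j)) =
      to_ac (\<Sum>(i, j)\<in>{(i, j). i \<le> d \<and> j \<le> d \<and> i + j = 2 * k}. (-1) ^ j * a i * a j)" for k
      by (simp add: to_ac_sum split_def)
    thus ?thesis
      using recurrence_iff_mult_reflection[OF two, of "\<lambda>i. to_ac (a i)" "\<lambda>i. to_ac (b i)" d] that
      by simp
  qed
  have IH: "(\<exists>u w. u \<in> primitive_roots_of_unity (2 ^ A) \<and> w \<in> primitive_roots_of_unity r \<and>
      recurrence_solution q d A u w n b) \<longleftrightarrow>
    (\<exists>y. - y \<in> primitive_roots_of_unity (2 ^ n * r) \<and> (\<forall>i\<le>d. to_ac (b i) = conj_sym q d i y))"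
    for b :: "nat \<Rightarrow> 'a"
    by (rule step.IH) (use step.prems in auto)
  show ?case
  proof
    assume "\<exists>u w. u \<in> primitive_roots_of_unity (2 ^ A) \<and> w \<in> primitive_roots_of_unity r \<and>
      recurrence_solution q d A u w (Suc n) a"
    then obtain u w where uw: "u \<in> primitive_roots_of_unity (2 ^ A)" "w \<in> primitive_roots_of_unity r"
      "recurrence_solution q d A u w (Suc n) a" by blast
    obtain b where b: "recurrence_solution q d A u w n b" "a 0 = 1"
      "\<forall>k\<in>{1..d}. (\<Sum>(i, j)\<in>{(i, j). i \<le> d \<and> j \<le> d \<and> i + j = 2 * k}. (-1) ^ j * a i * a j) = b k"
      using uw(3) by cases (use step.hyps in auto)
    obtain y where y: "- y \<in> primitive_roots_of_unity (2 ^ n * r)"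
      "\<forall>i\<le>d. to_ac (b i) = conj_sym q d i y"
      using IH[of b] b(1) uw(1,2) by blast
    have "to_ac (b 0) = 1" using y(2) by simp
    hence prod: "stretch d 1 (\<lambda>i. to_ac (a i)) * stretch d 1 (\<lambda>j. (-1) ^ j * to_ac (a j)) =
        stretch d 2 (\<lambda>i. to_ac (b i))"
      using transfer[of a b] b(2,3) by simp
    define f where "f = stretch d 1 a"
    have f: "lead_coeff f = 1" "degree f = d"
      using b(2) lead_coeff_stretch[of 1 a d] degree_stretch[of 1 a d] by (simp_all add: f_def)
    have mapf: "map_poly to_ac f = stretch d 1 (\<lambda>i. to_ac (a i))"
      by (simp only: f_def map_poly_to_ac_stretch)
    \<comment> \<open>Any root z of f will do. By the reflection identity z^2 is a root of the
      polynomial of level n, that is, a conjugate of \<open>- y\<close>, so z has twice the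
      order.\<close>
    obtain z where z: "poly (map_poly to_ac f) z = 0"
      using alg_closed_imp_poly_has_root[of "map_poly to_ac f"] f(2) d by auto
    have "poly (stretch d 2 (\<lambda>i. to_ac (b i))) z = 0"
      unfolding prod[symmetric] using z by (simp add: mapf)
    hence "poly (stretch d 1 (\<lambda>i. to_ac (b i))) (z ^ 2) = 0"
      by (simp only: poly_stretch[of d 2])
    also have "stretch d 1 (\<lambda>i. to_ac (b i)) = (\<Prod>j<d. [:y ^ q ^ j, 1:])"
      unfolding prod_conjugates_eq_stretch using y(2) by (intro stretch_cong) simp
    finally obtain j where "z ^ 2 = (- y) ^ q ^ j"
      by (auto simp: poly_prod q_def power_card_power_uminus eq_neg_iff_add_eq_0 add.commute)
    hence "z ^ 2 \<in> primitive_roots_of_unity (2 ^ n * r)"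
      using conjugate_in_primitive_roots[OF y(1) co(1)] by simp
    hence zr: "z \<in> primitive_roots_of_unity (2 * (2 ^ n * r))"
      using A0 by (rule primitive_root_sqrt)
    \<comment> \<open>Being monic of degree d, f is the product over the conjugates of its root z,
      so the tuple a belongs to \<open>- z\<close>.\<close>
    have "map_poly to_ac f = (\<Prod>j<d. [:- (z ^ q ^ j), 1:])"
      using map_poly_to_ac_eq_prod_conjugates[OF f(1) _ z zr] ordn(2) co(2) f(2) by (simp add: q_def)
    also have "\<dots> = stretch d 1 (\<lambda>i. conj_sym q d i (- z))"
      by (simp only: prod_conjugates_eq_stretch[symmetric] q_def power_card_power_uminus)
    finally have "\<forall>i\<le>d. to_ac (a i) = conj_sym q d i (- z)"
      unfolding mapf stretch_eq_iff .
    moreover have "- (- z) \<in> primitive_roots_of_unity (2 ^ Suc n * r)" using zr by (simp add: mult.assoc)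
    ultimately show "\<exists>y. - y \<in> primitive_roots_of_unity (2 ^ Suc n * r) \<and>
        (\<forall>i\<le>d. to_ac (a i) = conj_sym q d i y)"
      by blast
  next
    assume "\<exists>y. - y \<in> primitive_roots_of_unity (2 ^ Suc n * r) \<and>
        (\<forall>i\<le>d. to_ac (a i) = conj_sym q d i y)"
    then obtain y where y: "- y \<in> primitive_roots_of_unity (2 * (2 ^ n * r))"
      "\<forall>i\<le>d. to_ac (a i) = conj_sym q d i y" by (auto simp: mult.assoc)
    \<comment> \<open>The predecessor tuple is the one of - (y^2), since squaring the root
      \<open>- y\<close> gives y^2.\<close>
    have sq: "- (- (y ^ 2)) \<in> primitive_roots_of_unity (2 ^ n * r)"
      using primitive_root_power_mult[OF y(1)] by simp
    have "\<forall>i. \<exists>c :: 'a. to_ac c = conj_sym q d i (- (y ^ 2))"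
      using conj_sym_in_range_to_ac_if_ord[OF sq] ordn(1) unfolding q_def by (metis rangeE)
    then obtain b :: "nat \<Rightarrow> 'a" where b: "\<And>i. to_ac (b i) = conj_sym q d i (- (y ^ 2))" by metis
    obtain u w where uw: "u \<in> primitive_roots_of_unity (2 ^ A)" "w \<in> primitive_roots_of_unity r"
      "recurrence_solution q d A u w n b"
      using IH[of b] b sq by blast
    have "to_ac (a 0) = 1" "to_ac (b 0) = 1" using y(2) b by simp_all
    hence ab: "a 0 = 1" "b 0 = 1" by simp_all
    have "stretch d 1 (\<lambda>i. to_ac (a i)) = stretch d 1 (\<lambda>i. conj_sym q d i y)"
      "stretch d 1 (\<lambda>i. (-1) ^ i * to_ac (a i)) = stretch d 1 (\<lambda>i. (-1) ^ i * conj_sym q d i y)"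
      using y(2) by (auto intro!: stretch_cong)
    hence "stretch d 1 (\<lambda>i. to_ac (a i)) * stretch d 1 (\<lambda>j. (-1) ^ j * to_ac (a j)) =
        stretch d 2 (\<lambda>i. to_ac (b i))"
      using conjugates_mult_reflection[of d y] by (simp only: b q_def)
    hence "recurrence_solution q d A u w (Suc n) a"
      using transfer[of a b] ab by (intro recurrence_solution.step[OF uw(3)]) simp_all
    thus "\<exists>u w. u \<in> primitive_roots_of_unity (2 ^ A) \<and> w \<in> primitive_roots_of_unity r \<and>
      recurrence_solution q d A u w (Suc n) a"
      using uw(1,2) by blast
  qed
qed

section \<open>The factorizations for 2^n r\<close>

lemma stretch_eq_monom_add:
  assumes "c 0 = 1"
  shows "stretch d M c = monom 1 (M * d) + (\<Sum>i=1..d. monom (c i) (M * (d - i)))"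
  using assms by (simp add: stretch_def sum.atLeast_Suc_atMost)

text \<open>The bound l \<le> A keeps v in the base field. Here l = n with k = 0 serves n \<le> A,
  and l = A with k = n - A serves n > A for odd d.\<close>

lemma complete_factorization_ac_two_power:
  fixes A K k l r d :: nat
  defines "q \<equiv> CARD('a::{finite,field})"
  assumes q: "[q = 1] (mod 2 ^ A)" and l: "1 \<le> l" "l \<le> A" and r: "odd r" "coprime r q"
    and ord: "ord (2 ^ l * r) q = d" "ord (2 ^ (k + l) * r) q = 2 ^ k * d"
  shows "complete_factorization_ac (cyclotomic (2 ^ (k + l) * r) :: 'a poly)
    {stretch d (2 ^ k) (\<lambda>i. v ^ i * conj_sym q d i w) | v w.
      - v \<in> primitive_roots_of_unity (2 ^ l) \<and> w \<in> primitive_roots_of_unity r}"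
proof -
  have ql: "[q = 1] (mod 2 ^ l)"
    using l by (intro cong_dvd_modulus_nat[OF q]) (simp add: le_imp_power_dvd)
  hence "[q = 1] (mod 2)"
    using l by (intro cong_dvd_modulus_nat[OF ql]) simp
  hence oddq: "odd q" by (simp add: cong_def odd_iff_mod_2_eq_one)
  have "complete_factorization_ac (cyclotomic (2 ^ k * (2 ^ l * r)) :: 'a poly)
    {stretch (ord (2 ^ l * r) CARD('a)) (2 ^ k)
      (\<lambda>i. conj_sym CARD('a) (ord (2 ^ l * r) CARD('a)) i y) | y.
      - y \<in> primitive_roots_of_unity (2 ^ l * r)}"
    using l r oddq ord unfolding q_def
    by (intro complete_factorization_ac_stretch) (auto simp: power_add mult_ac intro!: Nat.gr0I)
  hence "complete_factorization_ac (cyclotomic (2 ^ (k + l) * r) :: 'a poly)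
    {stretch d (2 ^ k) (\<lambda>i. conj_sym q d i y) | y. - y \<in> primitive_roots_of_unity (2 ^ l * r)}"
    using ord(1) by (simp only: q_def power_add mult.assoc)
  thus ?thesis
    using stretch_conj_sym_primitive_root_mult[OF ql r(1), where 'a = 'a and d = d and M = "2 ^ k"] l
    by (simp add: q_def power_card_uminus)
qed

text \<open>N = n with k = 0 serves A < n \<le> K, and N = K with k = n - K serves n > K.\<close>

lemma complete_factorization_recurrence:
  fixes A N k r d :: nat
  defines "q \<equiv> CARD('a::{finite,field})"
  assumes A: "2 \<le> A" "[q = 1] (mod 2 ^ A)" and r: "odd r" "coprime r q" and N: "A \<le> N"
    and ord: "\<And>l. A \<le> l \<Longrightarrow> l \<le> N \<Longrightarrow> ord (2 ^ l * r) q = d"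
      "ord (2 ^ (k + N) * r) q = 2 ^ k * d"
  shows "complete_factorization (cyclotomic (2 ^ (k + N) * r))
    {monom 1 (2 ^ k * d) + (\<Sum>i=1..d. monom (a i) (2 ^ k * (d - i))) | u w (a :: nat \<Rightarrow> 'a).
      u \<in> primitive_roots_of_unity (2 ^ A) \<and> w \<in> primitive_roots_of_unity r \<and>
      recurrence_solution q d A u w N a}"
    (is "complete_factorization _ ?F")
proof -
  define C where "C = {a :: nat \<Rightarrow> 'a. \<exists>y. - y \<in> primitive_roots_of_unity (2 ^ N * r) \<and>
    (\<forall>i\<le>d. to_ac (a i) = conj_sym q d i y)}"
  have C: "a \<in> C \<longleftrightarrow> (\<exists>u w. u \<in> primitive_roots_of_unity (2 ^ A) \<and>
      w \<in> primitive_roots_of_unity r \<and> recurrence_solution q d A u w N a)" for a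
    unfolding C_def mem_Collect_eq
    using recurrence_solution_iff_conj_sym[where 'a = 'a, OF A(1) _ r(1), of N d a] A(2) r(2) ord(1) N
    by (simp add: q_def)
  have c0: "a 0 = 1" if "a \<in> C" for a
  proof -
    have "to_ac (a 0) = 1" using that by (auto simp: C_def)
    thus ?thesis by simp
  qed
  have "[q = 1] (mod 2)"
    using A by (intro cong_dvd_modulus_nat[OF A(2)]) (simp add: dvd_power)
  hence oddq: "odd q" by (simp add: cong_def odd_iff_mod_2_eq_one)
  have "complete_factorization (cyclotomic (2 ^ k * (2 ^ N * r)))
      (stretch (ord (2 ^ N * r) CARD('a)) (2 ^ k) ` {c :: nat \<Rightarrow> 'a.
        \<exists>y. - y \<in> primitive_roots_of_unity (2 ^ N * r) \<and>
          (\<forall>i\<le>ord (2 ^ N * r) CARD('a). to_ac (c i) = conj_sym CARD('a) (ord (2 ^ N * r) CARD('a)) i y)})"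
    using A(1) N r oddq ord unfolding q_def
    by (intro complete_factorization_stretch) (auto simp: power_add mult_ac intro!: Nat.gr0I)
  hence "complete_factorization (cyclotomic (2 ^ (k + N) * r)) (stretch d (2 ^ k) ` C)"
    using ord(1)[OF N order_refl] by (simp only: C_def q_def power_add mult.assoc)
  moreover have "stretch d (2 ^ k) ` C = ?F"
  proof -
    have "stretch d (2 ^ k) ` C =
        (\<lambda>a. monom 1 (2 ^ k * d) + (\<Sum>i=1..d. monom (a i) (2 ^ k * (d - i)))) ` C"
      using c0 by (intro image_cong refl stretch_eq_monom_add)
    also have "\<dots> = {monom 1 (2 ^ k * d) + (\<Sum>i=1..d. monom (a i) (2 ^ k * (d - i))) | a. a \<in> C}"
      by blast
    also have "\<dots> = ?F" unfolding C by blast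
    finally show ?thesis .
  qed
  ultimately show ?thesis by simp
qed

text \<open>The factor with coefficients u^i S_i,w is the product of the x + u w^(q^j) and has the
  roots - u w^(q^j). For n \<ge> 2 the element - u again has order 2^n. For n = 1 the only u is -1,
  and u itself would give roots of order r instead of 2r; hence the separate case with - u.\<close>

theorem theorem3p11:
  fixes q A m r d K n :: nat
    and U :: "nat \<Rightarrow> 'a::{finite,field} alg_closure set"
    and \<Omega> :: "'a alg_closure set"
    and \<Phi> :: "nat \<Rightarrow> 'a poly"
    and S :: "nat \<Rightarrow> 'a alg_closure \<Rightarrow> 'a alg_closure"
  assumes q_def: "q = CARD('a)"
    and q_cong: "[q = 1] (mod 4)"
    and q_eq: "q = 2 ^ A * m + 1"
    and A_ge: "A \<ge> 2"
    and m_odd: "odd m"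
    and r_ge: "r \<ge> 3"
    and r_odd: "odd r"
    and q_r_coprime: "coprime q r"
    and d_def: "d = ord r q"
    and K_def: "K = multiplicity 2 (q ^ d - 1)"
    and U_def: "\<And>k. U k = primitive_roots_of_unity (2 ^ k)"
    and Omega_def: "\<Omega> = primitive_roots_of_unity r"
    and Phi_def: "\<And>k. \<Phi> k = cyclotomic k"
    and S_def: "\<And>i w. S i w = conj_sym q d i w"
  shows
    "(n = 1 \<longrightarrow>
        complete_factorization_ac (\<Phi> (2 ^ n * r))
          {\<Sum>i=0..d. monom ((- u) ^ i * S i w) (d - i) | u w. u \<in> U n \<and> w \<in> \<Omega>})
   \<and> (2 \<le> n \<and> n \<le> A \<longrightarrow>
        complete_factorization_ac (\<Phi> (2 ^ n * r))
          {\<Sum>i=0..d. monom (u ^ i * S i w) (d - i) | u w. u \<in> U n \<and> w \<in> \<Omega>})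
   \<and> (n > A \<longrightarrow>
        (odd d \<longrightarrow>
          complete_factorization_ac (\<Phi> (2 ^ n * r))
            {\<Sum>i=0..d. monom (u ^ i * S i w) (2 ^ (n - A) * (d - i)) | u w. u \<in> U A \<and> w \<in> \<Omega>})
      \<and> (even d \<longrightarrow>
          (n \<le> K \<longrightarrow>
            complete_factorization (\<Phi> (2 ^ n * r))
              {monom 1 d + (\<Sum>i=1..d. monom (a i) (d - i)) | u w a.
                 u \<in> U A \<and> w \<in> \<Omega> \<and> recurrence_solution q d A u w n a})
        \<and> (n > K \<longrightarrow>
            complete_factorization (\<Phi> (2 ^ n * r))
              {monom 1 (2 ^ (n - K) * d) + (\<Sum>i=1..d. monom (a i) (2 ^ (n - K) * (d - i))) | u w a.
                 u \<in> U A \<and> w \<in> \<Omega> \<and> recurrence_solution q d A u w K a})))"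
proof -
  have q1: "q > 1" unfolding q_def by (rule card_field_gt_1)
  have cop: "coprime r q" using q_r_coprime by (simp add: coprime_commute)
  have d0: "d > 0" using cop by (simp add: d_def)
  have m0: "m > 0" using m_odd by (rule odd_pos)
  have "multiplicity 2 (q - 1) = A"
    using m_odd m0 by (simp add: q_eq prime_elem_multiplicity_mult_distrib not_dvd_imp_multiplicity_0)
  \<comment> \<open>Since v_2(q - 1) = A, lifting the exponent to d shows A \<le> K, with equality
    for odd d.\<close>
  hence K: "K = A + multiplicity 2 d"
    using multiplicity_2_power_minus_1[OF q1 q_cong d0] by (simp add: K_def)
  have "[2 ^ A * m + 1 = 0 + 1] (mod 2 ^ A)"
    by (intro cong_add cong_refl) (simp add: cong_0_iff)
  hence qA: "[q = 1] (mod 2 ^ A)" by (simp add: q_eq)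
  have ord: "ord (2 ^ k * r) q = 2 ^ (k - K) * d" for k
    using ord_two_power_mult[OF q1 q_cong r_odd q_r_coprime] by (simp add: d_def K_def)
  have ord_A: "ord (2 ^ k * r) q = d" if "k \<le> K" for k using ord[of k] that by simp
  note ac = complete_factorization_ac_two_power[where 'a = 'a and r = r and d = d and A = A,
      folded q_def, OF qA _ _ r_odd cop]
  note rec = complete_factorization_recurrence[where 'a = 'a and r = r and d = d and A = A,
      folded q_def, OF A_ge qA r_odd cop]
  have neg: "- v \<in> U k \<longleftrightarrow> v \<in> U k" if "k \<ge> 2" for v :: "'a alg_closure" and k
  proof -
    have "4 dvd (2 :: nat) ^ k" using le_imp_power_dvd[OF that, of "2 :: nat"] by simp
    thus ?thesis unfolding U_def
      using primitive_root_uminus[of v "2 ^ k"] primitive_root_uminus[of "- v" "2 ^ k"] by auto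
  qed
  show ?thesis
  proof (intro conjI impI)
    assume n: "n = 1"
    \<comment> \<open>\<open>U 1\<close> is not closed under negation, so the sign is kept by
      substituting v = - u.\<close>
    have swap: "(\<exists>v w. p = f v w \<and> - v \<in> V \<and> w \<in> W) \<longleftrightarrow>
        (\<exists>u w. p = f (- u) w \<and> u \<in> V \<and> w \<in> W)"
      for p and f :: "'a alg_closure \<Rightarrow> 'a alg_closure \<Rightarrow> 'a alg_closure poly" and V W
      by (metis minus_minus)
    have "n \<le> K" using n A_ge K by simp
    hence ord_n: "ord (2 ^ n * r) q = d" "ord (2 ^ (0 + n) * r) q = 2 ^ 0 * d"
      by (simp_all only: ord_A add_0 power_0 mult_1)
    have "complete_factorization_ac (\<Phi> (2 ^ (0 + n) * r))
        {stretch d (2 ^ 0) (\<lambda>i. v ^ i * S i w) | v w. - v \<in> U n \<and> w \<in> \<Omega>}"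
      unfolding Phi_def S_def U_def Omega_def
      by (rule ac[OF _ _ ord_n]) (use n A_ge in simp_all)
    moreover have "{stretch d (2 ^ 0) (\<lambda>i. v ^ i * S i w) | v w. - v \<in> U n \<and> w \<in> \<Omega>} =
        {stretch d (2 ^ 0) (\<lambda>i. (- u) ^ i * S i w) | u w. u \<in> U n \<and> w \<in> \<Omega>}"
      by (rule Collect_cong, rule swap)
    ultimately show "complete_factorization_ac (\<Phi> (2 ^ n * r))
        {\<Sum>i=0..d. monom ((- u) ^ i * S i w) (d - i) | u w. u \<in> U n \<and> w \<in> \<Omega>}"
      by (simp only: stretch_def power_0 mult_1 add_0)
  next
    assume n: "2 \<le> n \<and> n \<le> A"
    have "complete_factorization_ac (\<Phi> (2 ^ (0 + n) * r))
        {stretch d (2 ^ 0) (\<lambda>i. v ^ i * S i w) | v w. - v \<in> U n \<and> w \<in> \<Omega>}"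
      unfolding Phi_def S_def U_def Omega_def
      by (rule ac) (use n K in \<open>auto simp: ord_A\<close>)
    thus "complete_factorization_ac (\<Phi> (2 ^ n * r))
        {\<Sum>i=0..d. monom (u ^ i * S i w) (d - i) | u w. u \<in> U n \<and> w \<in> \<Omega>}"
      using n by (simp only: neg stretch_def power_0 mult_1 add_0)
  next
    assume n: "A < n" and "odd d"
    hence "K = A" using K by (simp add: not_dvd_imp_multiplicity_0)
    have "complete_factorization_ac (\<Phi> (2 ^ (n - A + A) * r))
        {stretch d (2 ^ (n - A)) (\<lambda>i. v ^ i * S i w) | v w. - v \<in> U A \<and> w \<in> \<Omega>}"
      unfolding Phi_def S_def U_def Omega_def
      by (rule ac) (use n A_ge \<open>K = A\<close> in \<open>auto simp: ord\<close>)
    moreover have "n - A + A = n" using n by simp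
    ultimately show "complete_factorization_ac (\<Phi> (2 ^ n * r))
        {\<Sum>i=0..d. monom (u ^ i * S i w) (2 ^ (n - A) * (d - i)) | u w. u \<in> U A \<and> w \<in> \<Omega>}"
      using A_ge by (simp only: neg stretch_def)
  next
    assume n: "A < n" "n \<le> K"
    have "complete_factorization (\<Phi> (2 ^ (0 + n) * r))
        {monom 1 (2 ^ 0 * d) + (\<Sum>i=1..d. monom (a i) (2 ^ 0 * (d - i))) | u w a.
          u \<in> U A \<and> w \<in> \<Omega> \<and> recurrence_solution q d A u w n a}"
      unfolding Phi_def U_def Omega_def by (rule rec) (use n in \<open>auto simp: ord_A\<close>)
    thus "complete_factorization (\<Phi> (2 ^ n * r))
        {monom 1 d + (\<Sum>i=1..d. monom (a i) (d - i)) | u w a.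
          u \<in> U A \<and> w \<in> \<Omega> \<and> recurrence_solution q d A u w n a}"
      by (simp only: power_0 mult_1 add_0)
  next
    assume n: "K < n"
    have "complete_factorization (\<Phi> (2 ^ (n - K + K) * r))
        {monom 1 (2 ^ (n - K) * d) + (\<Sum>i=1..d. monom (a i) (2 ^ (n - K) * (d - i))) | u w a.
          u \<in> U A \<and> w \<in> \<Omega> \<and> recurrence_solution q d A u w K a}"
      unfolding Phi_def U_def Omega_def by (rule rec) (use n K in \<open>auto simp: ord\<close>)
    moreover have "n - K + K = n" using n by simp
    ultimately show "complete_factorization (\<Phi> (2 ^ n * r))
        {monom 1 (2 ^ (n - K) * d) + (\<Sum>i=1..d. monom (a i) (2 ^ (n - K) * (d - i))) | u w a.
          u \<in> U A \<and> w \<in> \<Omega> \<and> recurrence_solution q d A u w K a}"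
      by simp
  qed
qed

end
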